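(* Let $(B^H_t)_{t\ge0}$ be a $d$-dimensional fractional Brownian motion of Hurst index $H\in(0,1)$ and let $T>0$. Then for any $0<\rho<1/(2H)$ there exists $\gamma>1/2$ such that with probability one the sample paths of $B^H$ on $[0,T]$ are $(\rho,\gamma)$-irregular.
   Context: Fractional Brownian motion of Hurst index $H\in(0,1)$ in $\mathbb R^d$: the centered continuous Gaussian process with i.i.d. components, each with covariance proportional (by a positive constant) to $t^{2H}+s^{2H}-|t-s|^{2H}$. For $w\in C([0,T];\mathbb R^d)$ put $\Phi^w_t(a)=\int_0^te^{i\langle a,w_r\rangle}\,dr$, $a\in\mathbb R^d$, $t\in[0,T]$, and $$\|\Phi^w\|_{\mathcal W^{\rho,\gamma}_T}=\sup_{a\in\mathbb R^d}\ \sup_{0\le s<t\le T}(1+|a|)^\rho\,\frac{|\Phi^w_t(a)-\Phi^w_s(a)|}{|t-s|^\gamma}.$$ For $\rho,\gamma>0$, $w$ is called $(\rho,\gamma)$-irregular if $\|\Phi^w\|_{\mathcal W^{\rho,\gamma}_T}<+\infty$. *)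

theory Defs
  imports "HOL-Probability.Probability"
begin

text \<open>Degenerate (almost surely constant) variables count as Gaussian; this is needed already
  for the value at time 0 of a fractional Brownian motion.\<close>

definition gaussian_rv :: "'a measure \<Rightarrow> ('a \<Rightarrow> real) \<Rightarrow> bool" where
  "gaussian_rv M X \<longleftrightarrow>
     X \<in> borel_measurable M \<and>
     ((\<exists>\<mu> \<sigma>. 0 < \<sigma> \<and> distributed M lborel X (\<lambda>x. ennreal (normal_density \<mu> \<sigma> x))) \<or>
      (\<exists>\<mu>. AE \<omega> in M. X \<omega> = \<mu>))"

definition gaussian_process :: "'a measure \<Rightarrow> 't set \<Rightarrow> ('t \<Rightarrow> 'a \<Rightarrow> real) \<Rightarrow> bool" where
  "gaussian_process M I X \<longleftrightarrow>
     (\<forall>J c. finite J \<longrightarrow> J \<subseteq> I \<longrightarrow> gaussian_rv M (\<lambda>\<omega>. \<Sum>t\<in>J. c t * X t \<omega>))"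

definition covariance :: "'a measure \<Rightarrow> ('a \<Rightarrow> real) \<Rightarrow> ('a \<Rightarrow> real) \<Rightarrow> real" where
  "covariance M X Y =
     (\<integral>\<omega>. (X \<omega> - (\<integral>\<omega>'. X \<omega>' \<partial>M)) * (Y \<omega> - (\<integral>\<omega>'. Y \<omega>' \<partial>M)) \<partial>M)"

text \<open>The \<open>i\<close>-th component, as a random element of the space of real functions on
  \<open>[0,\<infinity>)\<close> with the product \<open>\<sigma>\<close>-algebra.\<close>

definition component_path :: "(real \<Rightarrow> 'a \<Rightarrow> real ^ 'n) \<Rightarrow> 'n \<Rightarrow> 'a \<Rightarrow> real \<Rightarrow> real" where
  "component_path B i \<omega> = (\<lambda>t\<in>{0..}. B t \<omega> $ i)"

definition path_space :: "(real \<Rightarrow> real) measure" where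
  "path_space = PiM {0..} (\<lambda>_. borel)"

text \<open>Continuity of the sample paths is only required almost surely. Only the values \<open>B t\<close> with
  \<open>t \<ge> 0\<close> are constrained.\<close>

definition fractional_brownian_motion ::
    "'a measure \<Rightarrow> real \<Rightarrow> (real \<Rightarrow> 'a \<Rightarrow> real ^ 'n) \<Rightarrow> bool" where
  "fractional_brownian_motion M H B \<longleftrightarrow>
     prob_space.indep_vars M (\<lambda>_. path_space) (component_path B) UNIV \<and>
     (\<forall>i j. distr M path_space (component_path B i) = distr M path_space (component_path B j)) \<and>
     (\<forall>i. gaussian_process M {0..} (\<lambda>t \<omega>. B t \<omega> $ i)) \<and>
     (\<forall>i. \<forall>t\<ge>0. (\<integral>\<omega>. B t \<omega> $ i \<partial>M) = 0) \<and>
     (\<exists>c>0. \<forall>i. \<forall>s\<ge>0. \<forall>t\<ge>0.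
        covariance M (\<lambda>\<omega>. B s \<omega> $ i) (\<lambda>\<omega>. B t \<omega> $ i)
          = c * (t powr (2 * H) + s powr (2 * H) - \<bar>t - s\<bar> powr (2 * H))) \<and>
     (AE \<omega> in M. continuous_on {0..} (\<lambda>t. B t \<omega>))"

definition Phi :: "(real \<Rightarrow> real ^ 'n) \<Rightarrow> real \<Rightarrow> real ^ 'n \<Rightarrow> complex" where
  "Phi w t a = integral {0..t} (\<lambda>r. exp (\<i> * complex_of_real (a \<bullet> w r)))"

definition W_norm ::
    "real \<Rightarrow> real \<Rightarrow> real \<Rightarrow> (real \<Rightarrow> real ^ 'n \<Rightarrow> complex) \<Rightarrow> ennreal" where
  "W_norm \<rho> \<gamma> T F =
     (SUP a. SUP (s, t) \<in> {(s, t). 0 \<le> s \<and> s < t \<and> t \<le> T}.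
        ennreal ((1 + norm a) powr \<rho> * (norm (F t a - F s a) / \<bar>t - s\<bar> powr \<gamma>)))"

definition irregular :: "real \<Rightarrow> real \<Rightarrow> real \<Rightarrow> (real \<Rightarrow> real ^ 'n) \<Rightarrow> bool" where
  "irregular \<rho> \<gamma> T w \<longleftrightarrow>
     0 < \<rho> \<and> 0 < \<gamma> \<and> continuous_on {0..T} w \<and> W_norm \<rho> \<gamma> T (Phi w) < \<infinity>"

end

theory Submission
  imports Defs "HOL-Combinatorics.Multiset_Permutations"
begin

text \<open>
  The components of a fractional Brownian motion have the covariance of the Mandelbrot--van Ness
  kernels \<open>K\<^sub>t(u) = (t - u)\<^sub>+ powr (H - 1/2) - (-u)\<^sub>+ powr (H - 1/2)\<close> in \<open>L\<^sup>2(\<real>)\<close>. On \<open>(s, t)\<close> only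
  kernels with index later than \<open>s\<close> are nonzero; this gives local nondeterminism: for times
  \<open>r\<^sub>1 \<ge> \<dots> \<ge> r\<^sub>2\<^sub>p \<ge> 0\<close> and signs \<open>e\<^sub>j\<close>, the variance of \<open>\<Sum>\<^sub>j e\<^sub>j B(r\<^sub>j)\<close> dominates
  \<open>\<Sum>\<^sub>j \<bar>r\<^sub>2\<^sub>j\<^sub>-\<^sub>1 - r\<^sub>2\<^sub>j\<bar> powr (2 H)\<close>. Because the pairs \<open>(r\<^sub>2\<^sub>j\<^sub>-\<^sub>1, r\<^sub>2\<^sub>j)\<close> are disjoint, expanding the \<open>2p\<close>-th
  moment of a Riemann sum and sorting the times yields \<open>(2p)!\<close> times the \<open>p\<close>-th power of a double
  sum, and Fatou's lemma gives
  \<open>E \<bar>\<Phi>\<^sub>t(a) - \<Phi>\<^sub>s(a)\<bar> ^ (2p) \<le> C ((t - s) \<bar>a\<bar> powr (-q)) ^ p\<close> for every \<open>q < 1 / H\<close>.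

  Since \<open>\<bar>\<Phi>\<^sub>t(a) - \<Phi>\<^sub>s(a)\<bar> \<le> t - s\<close> and \<open>\<Phi>\<close> is Lipschitz in \<open>a\<close> along a bounded path, for
  \<open>\<bar>a\<bar>\<close> close to \<open>k\<close> it suffices to control \<open>\<Phi>\<close> on a grid of times and frequencies whose mesh is
  a power of \<open>1/k\<close>. There are polynomially many grid points, so summing the moments with \<open>p\<close> large
  bounds all grid increments almost surely; no chaining is needed.
\<close>

section \<open>The Mandelbrot--van Ness kernel\<close>

text \<open>The positive part needs the case distinction: \<open>powr\<close> of a negative number
  is not 0 but the exponential of a multiple of a logarithm.\<close>

definition pos_powr :: "real \<Rightarrow> real \<Rightarrow> real" where
  "pos_powr H u = (if 0 < u then u powr (H - 1/2) else 0)"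

definition mvn_kernel :: "real \<Rightarrow> real \<Rightarrow> real \<Rightarrow> real" where
  "mvn_kernel H t u = pos_powr H (t - u) - pos_powr H (- u)"

lemma pos_powr_measurable [measurable]: "pos_powr H \<in> borel_measurable borel"
  unfolding pos_powr_def by measurable

lemma integrable_indicator_has_integral:
  fixes f :: "real \<Rightarrow> real"
  assumes "f \<in> borel_measurable borel" "A \<in> sets borel" "(f has_integral I) A"
    and "\<And>x. x \<in> A \<Longrightarrow> 0 \<le> f x"
  shows "has_bochner_integral lborel (\<lambda>x. indicator A x * f x) I"
proof (rule has_bochner_integral_nn_integral)
  show "0 \<le> I" using assms(3,4) by (rule has_integral_nonneg)
  show "(\<integral>\<^sup>+ x. ennreal (indicat_real A x * f x) \<partial>lborel) = ennreal I"
    using nn_integral_has_integral_lebesgue[OF assms(4,3)] .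
qed (use assms in \<open>auto simp: indicator_def\<close>)

lemma integrable_pos_powr_square:
  assumes "0 < H" "0 \<le> c"
  shows "has_bochner_integral lborel (\<lambda>u. indicator {0..c} u * (pos_powr H u)\<^sup>2) (c powr (2 * H) / (2 * H))"
proof -
  have "has_bochner_integral lborel (\<lambda>u. indicator {0..c} u * u powr (2 * H - 1)) (c powr (2 * H) / (2 * H))"
    using has_integral_powr_from_0[of "2 * H - 1" c] assms
    by (intro integrable_indicator_has_integral) auto
  also have "(\<lambda>u. indicator {0..c} u * u powr (2 * H - 1)) = (\<lambda>u. indicator {0..c} u * (pos_powr H u)\<^sup>2)"
    by (auto simp: fun_eq_iff indicator_def pos_powr_def power2_eq_square simp flip: powr_add)
  finally show ?thesis .
qed

lemma square_diff_le: "(x - y :: real)\<^sup>2 \<le> 2 * x\<^sup>2 + 2 * y\<^sup>2"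
  using zero_le_power2[of "x + y"] by (simp add: power2_eq_square algebra_simps)

text \<open>Mean value theorem: the derivative is at most \<open>z powr (H - 3/2)\<close> in
  modulus, which decreases in \<open>z\<close>. Since H < 1, the exponent 2H - 3 lies below -1, so
  the square is integrable at infinity.\<close>

lemma pos_powr_diff_le:
  assumes "0 < H" "H < 1" "1 \<le> v"
  shows "(pos_powr H (1 + v) - pos_powr H v)\<^sup>2 \<le> v powr (2 * H - 3)"
proof -
  have "((\<lambda>x. x powr (H - 1/2)) has_real_derivative (H - 1/2) * x powr (H - 1/2 - 1)) (at x)" if "v \<le> x" for x
    using that assms by (intro has_real_derivative_powr) auto
  then obtain z where z: "v < z" "z < v + 1"
      "(v + 1) powr (H - 1/2) - v powr (H - 1/2) = (v + 1 - v) * ((H - 1/2) * z powr (H - 1/2 - 1))"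
    using MVT2[of v "v + 1" "\<lambda>x. x powr (H - 1/2)" "\<lambda>x. (H - 1/2) * x powr (H - 1/2 - 1)"]
    by fastforce
  have "\<bar>H - 1/2\<bar> * z powr (H - 3/2) \<le> 1 * v powr (H - 3/2)"
    using assms z by (intro mult_mono powr_mono2') auto
  hence "\<bar>pos_powr H (1 + v) - pos_powr H v\<bar> \<le> v powr (H - 3/2)"
    using z assms by (simp add: pos_powr_def abs_mult add.commute)
  hence "(pos_powr H (1 + v) - pos_powr H v)\<^sup>2 \<le> (v powr (H - 3/2))\<^sup>2"
    by (metis power2_abs power_mono abs_ge_zero)
  also have "\<dots> = v powr (2 * H - 3)"
    by (simp add: power2_eq_square flip: powr_add)
  finally show ?thesis .
qed

lemma integrable_pos_powr_diff:
  assumes "0 < H" "H < 1"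
  shows "integrable lborel (\<lambda>v. (pos_powr H (1 + v) - pos_powr H v)\<^sup>2)"
proof (rule Bochner_Integration.integrable_bound)
  \<comment> \<open>The summands treat the singularity at -1, the one at 0, and the tail. On (0,1]
    the term at 1 + v has square at most 1 + v, hence at most 2, and \<open>square_diff_le\<close>
    doubles it to the constant 4.\<close>
  let ?g = "\<lambda>v. indicator {0..1} (1 + 1 * v) * (pos_powr H (1 + 1 * v))\<^sup>2
      + (indicator {0..1} v * 4 + 2 * (indicator {0..1} v * (pos_powr H v)\<^sup>2)
      + indicator {1..} v * v powr (2 * H - 3))"
  have i1: "integrable lborel (\<lambda>u. indicator {0..1} u * (pos_powr H u)\<^sup>2)"
    using integrable_pos_powr_square[OF assms(1), of 1] by (simp add: has_bochner_integral_iff)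
  have i2: "integrable lborel (\<lambda>v. indicator {1..} v * v powr (2 * H - 3))"
    using integrable_indicator_has_integral[OF _ _ has_integral_powr_to_inf[of "2*H-3" 1]] assms
    by (auto simp: has_bochner_integral_iff)
  show "integrable lborel ?g"
    by (intro Bochner_Integration.integrable_add integrable_mult_right i1 i2
        lborel_integrable_real_affine[OF i1]) auto
  have "(pos_powr H (1 + v) - pos_powr H v)\<^sup>2 \<le> ?g v" for v
  proof -
    consider "v < -1" | "-1 \<le> v" "v \<le> 0" | "0 < v" "v \<le> 1" | "1 < v" by linarith
    then show ?thesis
    proof cases
      case 3
      have "(1 + v) powr (2 * (H - 1/2)) \<le> (1 + v) powr 1"
        using 3 assms by (intro powr_mono) auto
      hence "(pos_powr H (1 + v))\<^sup>2 \<le> 2"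
        using 3 by (simp add: pos_powr_def power2_eq_square flip: powr_add)
      thus ?thesis using square_diff_le[of "pos_powr H (1+v)" "pos_powr H v"] 3
        by (cases "v = 1") (auto simp: indicator_def)
    next
      case 4
      thus ?thesis using pos_powr_diff_le[OF assms, of v] by (simp add: indicator_def)
    qed (auto simp: pos_powr_def indicator_def)
  qed
  thus "AE v in lborel. norm ((pos_powr H (1 + v) - pos_powr H v)\<^sup>2) \<le> norm (?g v)"
    by (intro AE_I2) (smt (verit, best) real_norm_def zero_le_power2)
qed simp

text \<open>After the reflection u = -v this is the squared L2 norm of the kernel of the unit
  increment, \<open>mvn_kernel H 1\<close>.\<close>

definition mvn_const :: "real \<Rightarrow> real" where
  "mvn_const H = (LINT v|lborel. (pos_powr H (1 + v) - pos_powr H v)\<^sup>2)"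

text \<open>On [-1,0] the second term of the integrand vanishes, and the first alone contributes
  1/(2H).\<close>

lemma mvn_const_pos:
  assumes "0 < H" "H < 1"
  shows "0 < mvn_const H"
proof -
  have i1: "has_bochner_integral lborel (\<lambda>u. indicator {0..1} (1 + 1 * u) * (pos_powr H (1 + 1 * u))\<^sup>2) (1 / (2 * H) /\<^sub>R \<bar>1\<bar>)"
    using integrable_pos_powr_square[OF assms(1), of 1]
      iffD1[OF lborel_has_bochner_integral_real_affine_iff[of 1 "\<lambda>u. indicator {0..1} u * (pos_powr H u)\<^sup>2" _ 1]]
    by simp
  hence "0 < (LINT u|lborel. indicator {0..1} (1 + 1 * u) * (pos_powr H (1 + 1 * u))\<^sup>2)"
    using assms by (simp add: has_bochner_integral_iff)
  also have "\<dots> \<le> mvn_const H"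
    unfolding mvn_const_def using i1 assms
    by (intro integral_mono integrable_pos_powr_diff)
      (auto simp: has_bochner_integral_iff indicator_def pos_powr_def)
  finally show ?thesis .
qed

lemma pos_powr_scale: "0 < h \<Longrightarrow> pos_powr H (h * v) = h powr (H - 1/2) * pos_powr H v"
  by (auto simp: pos_powr_def powr_mult zero_less_mult_iff)

text \<open>Stationarity and self-similarity of the increments: the substitution u = s - h v with h
  = t - s turns the integrand into \<open>h powr (2 * H - 1)\<close> times that of
  \<open>mvn_const\<close>, and the Jacobian supplies the missing factor h.\<close>

lemma integral_mvn_kernel_diff:
  assumes "0 < H" "H < 1"
  shows "has_bochner_integral lborel (\<lambda>u. (mvn_kernel H t u - mvn_kernel H s u)\<^sup>2)
           (mvn_const H * \<bar>t - s\<bar> powr (2 * H))"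
proof -
  have less: "has_bochner_integral lborel (\<lambda>u. (mvn_kernel H t u - mvn_kernel H s u)\<^sup>2)
           (mvn_const H * \<bar>t - s\<bar> powr (2 * H))" if "s < t" for s t
  proof -
    define h where "h = t - s"
    have h: "0 < h" using that by (simp add: h_def)
    have "has_bochner_integral lborel (\<lambda>v. h powr (2 * H - 1) * (pos_powr H (1 + v) - pos_powr H v)\<^sup>2)
        (h powr (2 * H - 1) * mvn_const H)"
      using integrable_pos_powr_diff[OF assms]
      by (intro has_bochner_integral_mult_right) (simp add: has_bochner_integral_iff mvn_const_def)
    also have "(\<lambda>v. h powr (2 * H - 1) * (pos_powr H (1 + v) - pos_powr H v)\<^sup>2)
        = (\<lambda>v. (mvn_kernel H t (s + (- h) * v) - mvn_kernel H s (s + (- h) * v))\<^sup>2)"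
    proof
      fix v
      have "mvn_kernel H t (s + (- h) * v) - mvn_kernel H s (s + (- h) * v)
          = pos_powr H (h * (1 + v)) - pos_powr H (h * v)"
        by (simp add: mvn_kernel_def h_def algebra_simps)
      also have "\<dots>\<^sup>2 = (h powr (H - 1/2))\<^sup>2 * (pos_powr H (1 + v) - pos_powr H v)\<^sup>2"
        using h by (simp add: pos_powr_scale power_mult_distrib flip: right_diff_distrib)
      also have "(h powr (H - 1/2))\<^sup>2 = h powr (2 * H - 1)"
        by (simp add: power2_eq_square flip: powr_add)
      finally show "h powr (2 * H - 1) * (pos_powr H (1 + v) - pos_powr H v)\<^sup>2
          = (mvn_kernel H t (s + (- h) * v) - mvn_kernel H s (s + (- h) * v))\<^sup>2" by simp
    qed
    also have "h powr (2 * H - 1) * mvn_const H = (mvn_const H * h powr (2 * H)) /\<^sub>R \<bar>- h\<bar>"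
      using h by (simp add: powr_diff field_simps)
    finally show ?thesis
      using lborel_has_bochner_integral_real_affine_iff[of "-h" "\<lambda>u. (mvn_kernel H t u - mvn_kernel H s u)\<^sup>2"
          "mvn_const H * h powr (2 * H)" s] h by (simp add: h_def)
  qed
  consider "s < t" | "t < s" | "s = t" by linarith
  thus ?thesis
    by cases (use less[of s t] less[of t s] in \<open>auto simp: power2_commute abs_minus_commute\<close>)
qed

lemma mvn_kernel_0 [simp]: "mvn_kernel H 0 u = 0"
  by (simp add: mvn_kernel_def)

text \<open>Polarization of the increment formula, using that the kernel at time 0 vanishes. The
  result is the covariance of fractional Brownian motion up to a constant factor.\<close>

lemma integral_mvn_kernel_mult:
  assumes "0 < H" "H < 1" "0 \<le> s" "0 \<le> t"
  shows "has_bochner_integral lborel (\<lambda>u. mvn_kernel H s u * mvn_kernel H t u)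
           (mvn_const H / 2 * (t powr (2 * H) + s powr (2 * H) - \<bar>t - s\<bar> powr (2 * H)))"
proof -
  have "has_bochner_integral lborel
     (\<lambda>u. 1/2 * ((mvn_kernel H t u - mvn_kernel H 0 u)\<^sup>2 + (mvn_kernel H s u - mvn_kernel H 0 u)\<^sup>2
        - (mvn_kernel H t u - mvn_kernel H s u)\<^sup>2))
     (1/2 * (mvn_const H * \<bar>t - 0\<bar> powr (2 * H) + mvn_const H * \<bar>s - 0\<bar> powr (2 * H)
        - mvn_const H * \<bar>t - s\<bar> powr (2 * H)))"
    by (intro has_bochner_integral_mult_right has_bochner_integral_diff has_bochner_integral_add
        integral_mvn_kernel_diff assms)
  thus ?thesis using assms
    by (simp add: power2_eq_square algebra_simps flip: add_divide_distrib diff_divide_distrib)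
qed

section \<open>Local nondeterminism\<close>

text \<open>Lists of (coefficient, time) pairs allow repeated times, so that sorting by time,
  merging equal times and moving a single time are list operations that induction can
  follow.\<close>

definition lin_comb :: "(real \<Rightarrow> real) \<Rightarrow> (real \<times> real) list \<Rightarrow> real" where
  "lin_comb X zs = (\<Sum>(e, r)\<leftarrow>zs. e * X r)"

lemma lin_comb_Nil [simp]: "lin_comb X [] = 0"
  and lin_comb_Cons [simp]: "lin_comb X ((e, r) # zs) = e * X r + lin_comb X zs"
  by (simp_all add: lin_comb_def)

lemma lin_comb_nth: "lin_comb X zs = (\<Sum>i<length zs. fst (zs ! i) * X (snd (zs ! i)))"
  by (simp add: lin_comb_def sum_list_sum_nth case_prod_unfold atLeast0LessThan)

lemma lin_comb_mset: "mset zs = mset zs' \<Longrightarrow> lin_comb X zs = lin_comb X zs'"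
  by (simp add: lin_comb_def flip: sum_mset_sum_list)

text \<open>Serves two measures: with Lebesgue measure and the kernels it computes
  \<open>energy\<close>, with the probability measure and the process it computes the variance.
  Comparing the two quadratic forms identifies them up to a factor.\<close>

lemma lin_comb_square_integral:
  assumes "\<And>s t. s \<in> snd ` set zs \<Longrightarrow> t \<in> snd ` set zs \<Longrightarrow>
      has_bochner_integral N (\<lambda>u. Y s u * Y t u) (\<kappa> s t)"
  shows "has_bochner_integral N (\<lambda>u. (lin_comb (\<lambda>r. Y r u) zs)\<^sup>2)
      (\<Sum>i<length zs. \<Sum>j<length zs. fst (zs ! i) * fst (zs ! j) * \<kappa> (snd (zs ! i)) (snd (zs ! j)))"
proof -
  have "has_bochner_integral N (\<lambda>u. \<Sum>i<length zs. \<Sum>j<length zs.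
      fst (zs ! i) * fst (zs ! j) * (Y (snd (zs ! i)) u * Y (snd (zs ! j)) u))
      (\<Sum>i<length zs. \<Sum>j<length zs. fst (zs ! i) * fst (zs ! j) * \<kappa> (snd (zs ! i)) (snd (zs ! j)))"
    by (intro has_bochner_integral_sum has_bochner_integral_mult_right assms) auto
  moreover have "(lin_comb (\<lambda>r. Y r u) zs)\<^sup>2 = (\<Sum>i<length zs. \<Sum>j<length zs.
      fst (zs ! i) * fst (zs ! j) * (Y (snd (zs ! i)) u * Y (snd (zs ! j)) u))" for u
    by (simp add: lin_comb_nth power2_eq_square sum_product mult_ac)
  ultimately show ?thesis by simp
qed

text \<open>Up to a constant factor this is the variance of the linear combination of the values of
  one component of the process.\<close>

definition energy :: "real \<Rightarrow> (real \<times> real) list \<Rightarrow> real" where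
  "energy H zs = (LINT u|lborel. (lin_comb (\<lambda>r. mvn_kernel H r u) zs)\<^sup>2)"

lemma energy_nonneg: "0 \<le> energy H zs"
  by (simp add: energy_def)

lemma energy_merge: "energy H ((a, r) # (b, r) # zs) = energy H ((a + b, r) # zs)"
  by (simp add: energy_def algebra_simps)

lemma energy_zero_Cons: "energy H ((0, r) # zs) = energy H zs"
  by (simp add: energy_def)

lemma integrable_energy:
  assumes "0 < H" "H < 1" "\<And>e r. (e, r) \<in> set zs \<Longrightarrow> 0 \<le> r"
  shows "integrable lborel (\<lambda>u. (lin_comb (\<lambda>r. mvn_kernel H r u) zs)\<^sup>2)"
  by (rule has_bochner_integral_iff[THEN iffD1, THEN conjunct1], rule lin_comb_square_integral,
      rule integral_mvn_kernel_mult) (use assms in auto)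

text \<open>The reciprocal of the factor that the estimate in \<open>energy_step\<close>
  loses.\<close>

definition lnd_const :: "real \<Rightarrow> real" where
  "lnd_const H = 1 / (2 + 2 * H * (2 * mvn_const H + 1))"

lemma lnd_const_bounds:
  assumes "0 < H" "H < 1"
  shows "0 < lnd_const H" "lnd_const H \<le> 1"
proof -
  have "0 < 2 * H * (2 * mvn_const H + 1)" using mvn_const_pos[OF assms] assms by simp
  thus "0 < lnd_const H" "lnd_const H \<le> 1" by (auto simp: lnd_const_def)
qed

text \<open>For u in (s,t) every kernel of index at most s vanishes, and the part of
  \<open>mvn_kernel\<close> depending on -u vanishes because u is positive. Only
  \<open>c * (t - u) powr (H - 1/2)\<close> remains, and its square is integrated over this interval
  alone.\<close>

lemma energy_increment_lower:
  assumes H: "0 < H" "H < 1" and st: "0 \<le> s" "s \<le> t"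
    and zs: "\<And>e r. (e, r) \<in> set zs \<Longrightarrow> 0 \<le> r \<and> r \<le> s"
  shows "c\<^sup>2 * (t - s) powr (2 * H) \<le> 2 * H * energy H ((c, t) # zs)"
proof -
  have zero: "lin_comb (\<lambda>r. mvn_kernel H r u) zs = 0" if "s \<le> u" for u
    using zs that st(1)
  proof (induction zs)
    case (Cons z zs)
    obtain e r where z: "z = (e, r)" by (cases z)
    have "mvn_kernel H r u = 0"
      using Cons.prems(1)[of e r] Cons.prems(2,3) by (simp add: z mvn_kernel_def pos_powr_def)
    moreover have "lin_comb (\<lambda>r. mvn_kernel H r u) zs = 0"
      using Cons.prems by (intro Cons.IH) auto
    ultimately show ?case by (simp add: z)
  qed simp
  have "has_bochner_integral lborel
      (\<lambda>u. c\<^sup>2 * (indicator {0..t - s} (t + (-1) * u) * (pos_powr H (t + (-1) * u))\<^sup>2))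
      (c\<^sup>2 * ((t - s) powr (2 * H) / (2 * H)))"
    using integrable_pos_powr_square[OF H(1), of "t - s"] st
      iffD1[OF lborel_has_bochner_integral_real_affine_iff[of "-1" "\<lambda>u. indicator {0..t - s} u * (pos_powr H u)\<^sup>2" _ t]]
    by (intro has_bochner_integral_mult_right) simp
  hence i: "integrable lborel (\<lambda>u. c\<^sup>2 * (indicator {0..t - s} (t - u) * (pos_powr H (t - u))\<^sup>2))"
    "(LINT u|lborel. c\<^sup>2 * (indicator {0..t - s} (t - u) * (pos_powr H (t - u))\<^sup>2)) = c\<^sup>2 * ((t - s) powr (2 * H) / (2 * H))"
    by (simp_all add: has_bochner_integral_iff)
  have "c\<^sup>2 * ((t - s) powr (2 * H) / (2 * H)) \<le> energy H ((c, t) # zs)"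
    unfolding energy_def i(2)[symmetric]
  proof (rule integral_mono[OF i(1) integrable_energy[OF H]])
    show "0 \<le> r" if "(e, r) \<in> set ((c, t) # zs)" for e r
      using that zs st by auto
    show "c\<^sup>2 * (indicator {0..t - s} (t - u) * (pos_powr H (t - u))\<^sup>2)
        \<le> (lin_comb (\<lambda>r. mvn_kernel H r u) ((c, t) # zs))\<^sup>2" for u
      using zero[of u] st by (auto simp: indicator_def mvn_kernel_def pos_powr_def power_mult_distrib)
  qed
  hence "c\<^sup>2 * (t - s) powr (2 * H) / (2 * H) \<le> energy H ((c, t) # zs)" by simp
  thus ?thesis using H by (subst (asm) pos_divide_le_eq) (auto simp: mult_ac)
qed

text \<open>Lowering the latest time from t to s changes the combination by c times a kernel
  increment, whose squared norm is a multiple of \<open>c\<^sup>2 * (t - s) powr (2 * H)\<close>. By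
  \<open>energy_increment_lower\<close> this quantity is itself controlled by the energy before the
  move, so it can also be kept as a gain.\<close>

lemma energy_step:
  assumes H: "0 < H" "H < 1" and st: "0 \<le> s" "s \<le> t"
    and zs: "\<And>e r. (e, r) \<in> set zs \<Longrightarrow> 0 \<le> r \<and> r \<le> s"
  shows "lnd_const H * (energy H ((c, s) # zs) + c\<^sup>2 * (t - s) powr (2 * H)) \<le> energy H ((c, t) # zs)"
proof -
  let ?x = "c\<^sup>2 * (t - s) powr (2 * H)" and ?E = "energy H ((c, t) # zs)"
  let ?f = "\<lambda>r u. lin_comb (\<lambda>r. mvn_kernel H r u) ((c, r) # zs)"
  have i: "integrable lborel (\<lambda>u. (?f t u)\<^sup>2)" "integrable lborel (\<lambda>u. (?f s u)\<^sup>2)"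
    by (rule integrable_energy[OF H], use st zs in force)+
  have d: "has_bochner_integral lborel (\<lambda>u. c\<^sup>2 * (mvn_kernel H t u - mvn_kernel H s u)\<^sup>2)
      (c\<^sup>2 * (mvn_const H * \<bar>t - s\<bar> powr (2 * H)))"
    by (intro has_bochner_integral_mult_right integral_mvn_kernel_diff H)
  have "energy H ((c, s) # zs) \<le> (LINT u|lborel. 2 * (?f t u)\<^sup>2 + 2 * (c\<^sup>2 * (mvn_kernel H t u - mvn_kernel H s u)\<^sup>2))"
    unfolding energy_def
  proof (rule integral_mono)
    show "(?f s u)\<^sup>2 \<le> 2 * (?f t u)\<^sup>2 + 2 * (c\<^sup>2 * (mvn_kernel H t u - mvn_kernel H s u)\<^sup>2)" for u
      using square_diff_le[of "?f t u" "c * (mvn_kernel H t u - mvn_kernel H s u)"]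
      unfolding power_mult_distrib by (simp add: right_diff_distrib add.commute)
  qed (use i d in \<open>auto simp: has_bochner_integral_iff\<close>)
  also have "\<dots> = 2 * ?E + 2 * mvn_const H * ?x"
    using i d st by (subst Bochner_Integration.integral_add) (auto simp: has_bochner_integral_iff energy_def)
  finally have 1: "energy H ((c, s) # zs) + ?x \<le> 2 * ?E + (2 * mvn_const H + 1) * ?x"
    by (simp add: algebra_simps)
  also have "\<dots> \<le> 2 * ?E + (2 * mvn_const H + 1) * (2 * H * ?E)"
    using mvn_const_pos[OF H] energy_increment_lower[OF H st zs]
    by (intro add_left_mono mult_left_mono) auto
  also have "\<dots> = ?E / lnd_const H"
    by (simp add: lnd_const_def algebra_simps)
  finally show ?thesis
    using lnd_const_bounds[OF H] by (subst (asm) pos_le_divide_eq) (auto simp: mult_ac)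
qed

text \<open>The pairs are disjoint, so that the exponential of such a sum factors into independent
  two-variable functions; a sum over all neighbouring gaps would not.\<close>

fun pair_sum :: "(real \<Rightarrow> real \<Rightarrow> real) \<Rightarrow> real list \<Rightarrow> real" where
  "pair_sum d (u # v # xs) = d u v + pair_sum d xs"
| "pair_sum d xs = 0"

lemma odd_square_ge_1:
  assumes "odd (k :: int)"
  shows "1 \<le> (real_of_int k)\<^sup>2"
proof -
  have "1 \<le> \<bar>k\<bar>" using assms by (cases "k = 0") auto
  hence "1 \<le> \<bar>real_of_int k\<bar>" by linarith
  thus ?thesis using one_le_power[of "\<bar>real_of_int k\<bar>" 2] by simp
qed

text \<open>Removing the times of the list two at a time, from the latest one on, the coefficient in
  front of the current latest time is alternately even and odd; an odd integer has square at least 1.\<close>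

lemma energy_pairs_lower_even:
  assumes H: "0 < H" "H < 1"
  shows "sorted_wrt (\<ge>) (map snd zs) \<Longrightarrow> (\<And>e r. (e, r) \<in> set zs \<Longrightarrow> (e = 1 \<or> e = -1) \<and> 0 \<le> r \<and> r \<le> t)
    \<Longrightarrow> 0 \<le> t \<Longrightarrow>
    lnd_const H ^ length zs * pair_sum (\<lambda>u v. \<bar>u - v\<bar> powr (2 * H)) (map snd zs)
      \<le> energy H ((2 * real_of_int m, t) # zs)"
proof (induction zs arbitrary: m t rule: induct_list012)
  case (3 z1 z2 zs)
  let ?c = "lnd_const H" and ?P = "pair_sum (\<lambda>u v. \<bar>u - v\<bar> powr (2 * H)) (map snd zs)"
  note c = lnd_const_bounds[OF H]
  obtain e1 r1 e2 r2 where z: "z1 = (e1, r1)" "z2 = (e2, r2)" by (metis surj_pair)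
  have r: "0 \<le> r1" "r1 \<le> t" "0 \<le> r2" "r2 \<le> r1"
    using "3.prems"(1) "3.prems"(2)[of e1 r1] "3.prems"(2)[of e2 r2] by (auto simp: z)
  have rest: "(e = 1 \<or> e = -1) \<and> 0 \<le> r \<and> r \<le> r2" if "(e, r) \<in> set zs" for e r
    using "3.prems"(1) "3.prems"(2)[of e r] that by (auto simp: z)
  have rest2: "0 \<le> r \<and> r \<le> r1" if "(e, r) \<in> set ((e1, r1) # (e2, r2) # zs)" for e r
    using r rest[of e r] that by auto
  have e: "e1 \<in> {1, -1}" "e2 \<in> {1, -1}" using "3.prems"(2) by (auto simp: z)
  then obtain k1 k2 :: int where k: "e1 = real_of_int k1" "k1 \<in> {1,-1}" "e2 = real_of_int k2" "k2 \<in> {1,-1}"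
    by (metis insert_iff of_int_1 of_int_minus singletonD)
  \<comment> \<open>Two signs add up to an even number, so once both times have been absorbed the
    coefficient is even again and the induction hypothesis applies with
    \<open>m + j\<close>.\<close>
  have "even (k1 + k2)" using k by auto
  then obtain j where j: "k1 + k2 = 2 * j" by (elim evenE)
  let ?o = "2 * real_of_int m + e1"
  \<comment> \<open>The odd coefficient is carried from \<open>r1\<close> down to \<open>r2\<close>;
    this is the step that yields the gain for the pair.\<close>
  have o: "1 \<le> ?o\<^sup>2" using odd_square_ge_1[of "2 * m + k1"] k by auto
  have "?c ^ length zs * ?P \<le> energy H ((2 * real_of_int (m + j), r2) # zs)"
    using "3.prems"(1) rest r by (intro "3.IH"(1)) (auto simp: z)
  also have "2 * real_of_int (m + j) = ?o + e2" using arg_cong[OF j, of real_of_int] k by simp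
  finally have 1: "?c ^ length zs * ?P \<le> energy H ((?o, r2) # (e2, r2) # zs)"
    by (simp add: energy_merge)
  have "?c ^ length (z1 # z2 # zs) * (?P + \<bar>r1 - r2\<bar> powr (2 * H))
      = ?c * (?c * (?c ^ length zs * ?P + ?c ^ length zs * (1 * \<bar>r1 - r2\<bar> powr (2 * H))))"
    by (simp add: algebra_simps)
  also have "\<dots> \<le> ?c * (?c * (energy H ((?o, r2) # (e2, r2) # zs) + 1 * (?o\<^sup>2 * (r1 - r2) powr (2 * H))))"
    using 1 c o r
    by (intro mult_left_mono add_mono mult_mono) (auto simp: power_le_one)
  also have "\<dots> \<le> ?c * energy H ((?o, r1) # (e2, r2) # zs)"
    using c r rest by (subst mult_1_left, intro mult_left_mono[OF energy_step[OF H]]) auto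
  also have "energy H ((?o, r1) # (e2, r2) # zs) = energy H ((2 * real_of_int m, r1) # (e1, r1) # (e2, r2) # zs)"
    by (simp add: energy_merge)
  \<comment> \<open>The coefficient carried from \<open>t\<close> to \<open>r1\<close> is even and
    may be 0, so no gain is kept from this move; it only costs the second factor
    \<open>lnd_const H\<close> of the pair.\<close>
  also have "?c * \<dots> \<le> ?c * (energy H ((2 * real_of_int m, r1) # (e1, r1) # (e2, r2) # zs) + (2 * real_of_int m)\<^sup>2 * (t - r1) powr (2 * H))"
    using c by (intro mult_left_mono) auto
  also have "\<dots> \<le> energy H ((2 * real_of_int m, t) # (e1, r1) # (e2, r2) # zs)"
    using r rest2 by (intro energy_step H) auto
  finally show ?case by (simp add: z add.commute)
qed (auto simp: energy_nonneg)

text \<open>An artificial coefficient 0 at the latest time starts the induction with the even number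
  0 and does not change the energy.\<close>

lemma energy_pairs_lower:
  assumes H: "0 < H" "H < 1"
    and zs: "sorted_wrt (\<ge>) (map snd zs)" "\<And>e r. (e, r) \<in> set zs \<Longrightarrow> (e = 1 \<or> e = -1) \<and> 0 \<le> r"
  shows "lnd_const H ^ length zs * pair_sum (\<lambda>u v. \<bar>u - v\<bar> powr (2 * H)) (map snd zs) \<le> energy H zs"
proof (cases zs)
  case Nil
  then show ?thesis by (simp add: energy_nonneg)
next
  case (Cons z zs')
  have "lnd_const H ^ length zs * pair_sum (\<lambda>u v. \<bar>u - v\<bar> powr (2 * H)) (map snd zs)
      \<le> energy H ((2 * real_of_int 0, snd z) # zs)"
  proof (rule energy_pairs_lower_even[OF H zs(1)])
    show "(e = 1 \<or> e = -1) \<and> 0 \<le> r \<and> r \<le> snd z" if "(e, r) \<in> set zs" for e r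
      using zs(2)[OF that] zs(1) that by (auto simp: Cons)
    show "0 \<le> snd z" using zs(2)[of "fst z" "snd z"] Cons by simp
  qed
  thus ?thesis by (simp add: energy_zero_Cons)
qed

section \<open>Gaussian characteristic functions\<close>

lemma gaussian_rv_square_integrable:
  assumes "prob_space M" "gaussian_rv M X"
  shows "integrable M (\<lambda>\<omega>. (X \<omega>)\<^sup>2)"
proof -
  interpret prob_space M by fact
  have [measurable]: "X \<in> borel_measurable M" using assms(2) by (simp add: gaussian_rv_def)
  consider \<mu> \<sigma> where "0 < \<sigma>" "distributed M lborel X (\<lambda>x. ennreal (normal_density \<mu> \<sigma> x))"
    | \<mu> where "AE \<omega> in M. X \<omega> = \<mu>"
    using assms(2) by (auto simp: gaussian_rv_def)
  thus ?thesis
  proof cases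
    case 1
    have "integrable lborel (\<lambda>x. normal_density \<mu> \<sigma> x * (x - \<mu>)\<^sup>2
        + 2 * \<mu> * (normal_density \<mu> \<sigma> x * x) - \<mu>\<^sup>2 * normal_density \<mu> \<sigma> x)"
      using 1 by (intro Bochner_Integration.integrable_diff Bochner_Integration.integrable_add
          integrable_mult_right integrable_normal_moment integrable_normal_moment_nz_1 integrable_normal_density)
    moreover have "normal_density \<mu> \<sigma> x * (x - \<mu>)\<^sup>2
        + 2 * \<mu> * (normal_density \<mu> \<sigma> x * x) - \<mu>\<^sup>2 * normal_density \<mu> \<sigma> x = normal_density \<mu> \<sigma> x * x\<^sup>2" for x
      by (simp add: power2_eq_square algebra_simps)
    ultimately have "integrable lborel (\<lambda>x. normal_density \<mu> \<sigma> x * x\<^sup>2)" by simp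
    thus ?thesis
      using distributed_integrable[OF 1(2), of "\<lambda>x. x\<^sup>2"] by simp
  next
    case 2
    have "integrable M (\<lambda>\<omega>. (X \<omega>)\<^sup>2) \<longleftrightarrow> integrable M (\<lambda>_. \<mu>\<^sup>2)"
      using 2 by (intro integrable_cong_AE) auto
    thus ?thesis by simp
  qed
qed

text \<open>In the nondegenerate case X is rescaled to a standard normal variable. In the degenerate
  case the zero mean forces the constant to be 0, and both sides equal 1.\<close>

lemma gaussian_rv_char:
  assumes "prob_space M" "gaussian_rv M X" and mean: "(\<integral>\<omega>. X \<omega> \<partial>M) = 0"
  shows "char (distr M borel X) 1 = exp (- (\<integral>\<omega>. (X \<omega>)\<^sup>2 \<partial>M) / 2)"
proof -
  interpret prob_space M by fact
  have X [measurable]: "X \<in> borel_measurable M" using assms(2) by (simp add: gaussian_rv_def)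
  consider \<mu> \<sigma> where "0 < \<sigma>" "distributed M lborel X (\<lambda>x. ennreal (normal_density \<mu> \<sigma> x))"
    | \<mu> where "AE \<omega> in M. X \<omega> = \<mu>"
    using assms(2) by (auto simp: gaussian_rv_def)
  thus ?thesis
  proof cases
    case 1
    have "\<mu> = 0"
      using distributed_integral[OF 1(2), of "\<lambda>x. x"] integral_normal_moment_nz_1[OF 1(1), of \<mu>] mean
      by simp
    note D = 1(2)[unfolded this]
    have sq: "(\<integral>\<omega>. (X \<omega>)\<^sup>2 \<partial>M) = \<sigma>\<^sup>2"
      using distributed_integral[OF D, of "\<lambda>x. x\<^sup>2"] integral_normal_moment_even[OF 1(1), of 0 1]
      by (simp add: fact_numeral)
    have "distributed M lborel (\<lambda>x. (X x - 0) / \<sigma>) (\<lambda>x. ennreal (std_normal_density x))"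
      using D normal_standard_normal_convert[OF 1(1)] by blast
    hence Z: "distr M lborel (\<lambda>\<omega>. X \<omega> / \<sigma>) = std_normal_distribution"
      by (simp add: distributed_distr_eq_density)
    have "char (distr M borel X) 1 = (CLINT \<omega>|M. iexp (X \<omega>))"
      by (simp add: char_def integral_distr)
    also have "\<dots> = (CLINT \<omega>|M. iexp (\<sigma> * (X \<omega> / \<sigma>)))"
      using 1(1) by simp
    also have "\<dots> = (CLINT x|distr M lborel (\<lambda>\<omega>. X \<omega> / \<sigma>). iexp (\<sigma> * x))"
      by (subst integral_distr) auto
    also have "\<dots> = char std_normal_distribution \<sigma>"
      by (simp add: Z char_def)
    finally show ?thesis
      by (simp add: char_std_normal_distribution sq)
  next
    case 2
    have "(\<integral>\<omega>. X \<omega> \<partial>M) = (\<integral>\<omega>. \<mu> \<partial>M)" using 2 by (intro integral_cong_AE) auto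
    hence "\<mu> = 0" using mean by (simp add: prob_space)
    have "(\<integral>\<omega>. (X \<omega>)\<^sup>2 \<partial>M) = (\<integral>\<omega>. \<mu>\<^sup>2 \<partial>M)" using 2 by (intro integral_cong_AE) auto
    moreover have "(CLINT \<omega>|M. iexp (X \<omega>)) = (CLINT \<omega>|M. iexp \<mu>)"
      using 2 by (intro integral_cong_AE) auto
    ultimately show ?thesis
      using \<open>\<mu> = 0\<close> by (simp add: char_def integral_distr prob_space)
  qed
qed

section \<open>Finite linear combinations of the values of the process\<close>

lemma integrable_mult_of_square:
  fixes X Y :: "'a \<Rightarrow> real"
  assumes [measurable]: "X \<in> borel_measurable M" "Y \<in> borel_measurable M"
    and "integrable M (\<lambda>\<omega>. (X \<omega>)\<^sup>2)" "integrable M (\<lambda>\<omega>. (Y \<omega>)\<^sup>2)"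
  shows "integrable M (\<lambda>\<omega>. X \<omega> * Y \<omega>)"
proof (rule Bochner_Integration.integrable_bound)
  show "integrable M (\<lambda>\<omega>. (X \<omega>)\<^sup>2 + (Y \<omega>)\<^sup>2)" using assms by simp
  have "\<bar>x * y\<bar> \<le> x\<^sup>2 + y\<^sup>2" for x y :: real
    using zero_le_power2[of "\<bar>x\<bar> - \<bar>y\<bar>"] zero_le_power2[of x] zero_le_power2[of y]
    unfolding power2_diff power2_abs abs_mult by linarith
  thus "AE \<omega> in M. norm (X \<omega> * Y \<omega>) \<le> norm ((X \<omega>)\<^sup>2 + (Y \<omega>)\<^sup>2)"
    by (auto simp del: norm_mult)
qed simp

text \<open>\<open>gaussian_process\<close> speaks of sums over sets of distinct times, whereas a
  list may repeat a time; the coefficients belonging to equal times are therefore collected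
  first.\<close>

lemma gaussian_process_lin_comb:
  assumes "gaussian_process M {0..} X" "\<And>e r. (e, r) \<in> set zs \<Longrightarrow> 0 \<le> r"
  shows "gaussian_rv M (\<lambda>\<omega>. c * lin_comb (\<lambda>r. X r \<omega>) zs)"
proof -
  define J where "J = (\<lambda>i. snd (zs ! i)) ` {..<length zs}"
  define b where "b t = c * (\<Sum>i | i < length zs \<and> snd (zs ! i) = t. fst (zs ! i))" for t
  have "J \<subseteq> {0..}" using assms(2) by (auto simp: J_def) (metis nth_mem prod.collapse)
  hence "gaussian_rv M (\<lambda>\<omega>. \<Sum>t\<in>J. b t * X t \<omega>)"
    using assms(1) by (auto simp: gaussian_process_def J_def)
  moreover have "(\<Sum>t\<in>J. b t * X t \<omega>) = c * lin_comb (\<lambda>r. X r \<omega>) zs" for \<omega>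
  proof -
    have "lin_comb (\<lambda>r. X r \<omega>) zs = (\<Sum>t\<in>J. \<Sum>i | i \<in> {..<length zs} \<and> snd (zs ! i) = t. fst (zs ! i) * X (snd (zs ! i)) \<omega>)"
      unfolding J_def lin_comb_nth by (rule sum.image_gen) simp
    also have "\<dots> = (\<Sum>t\<in>J. (\<Sum>i | i < length zs \<and> snd (zs ! i) = t. fst (zs ! i)) * X t \<omega>)"
      unfolding sum_distrib_right by (intro sum.cong) auto
    finally show ?thesis by (simp add: b_def sum_distrib_left mult_ac)
  qed
  ultimately show ?thesis by simp
qed

lemma lin_comb_measurable:
  assumes "\<And>e r. (e, r) \<in> set zs \<Longrightarrow> X r \<in> borel_measurable M"
  shows "(\<lambda>\<omega>. lin_comb (\<lambda>r. X r \<omega>) zs) \<in> borel_measurable M"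
  using assms
proof (induction zs)
  case (Cons z zs)
  have [measurable]: "X (snd z) \<in> borel_measurable M" "(\<lambda>\<omega>. lin_comb (\<lambda>r. X r \<omega>) zs) \<in> borel_measurable M"
    using Cons.prems[of "fst z" "snd z"] Cons.prems by (auto intro!: Cons.IH)
  have "(\<lambda>\<omega>. fst z * X (snd z) \<omega> + lin_comb (\<lambda>r. X r \<omega>) zs) \<in> borel_measurable M"
    by measurable
  thus ?case by (cases z) simp
qed simp

lemma lin_comb_integral_zero:
  assumes "\<And>e r. (e, r) \<in> set zs \<Longrightarrow> has_bochner_integral M (X r) 0"
  shows "has_bochner_integral M (\<lambda>\<omega>. lin_comb (\<lambda>r. X r \<omega>) zs) 0"
  using assms
proof (induction zs)
  case (Cons z zs)
  have "has_bochner_integral M (\<lambda>\<omega>. fst z * X (snd z) \<omega> + lin_comb (\<lambda>r. X r \<omega>) zs) (fst z * 0 + 0)"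
    using Cons.prems[of "fst z" "snd z"] Cons.prems
    by (intro has_bochner_integral_add has_bochner_integral_mult_right Cons.IH) auto
  thus ?case by (cases z) simp
qed (simp add: has_bochner_integral_zero)

lemma lin_comb_inner:
  "lin_comb (\<lambda>r. a \<bullet> f r) zs = (\<Sum>i\<in>UNIV. a $ i * lin_comb (\<lambda>r. f r $ i) zs)"
  for a :: "real ^ 'n"
  by (induction zs) (auto simp: inner_vec_def algebra_simps sum.distrib sum_distrib_left)

lemma fbm_measurable:
  assumes "fractional_brownian_motion M H B" "0 \<le> t"
  shows "(\<lambda>\<omega>. B t \<omega> $ i) \<in> borel_measurable M"
    "gaussian_rv M (\<lambda>\<omega>. B t \<omega> $ i)"
proof -
  have "gaussian_rv M (\<lambda>\<omega>. 1 * lin_comb (\<lambda>r. B r \<omega> $ i) [(1, t)])"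
    using assms by (intro gaussian_process_lin_comb) (auto simp: fractional_brownian_motion_def)
  thus "gaussian_rv M (\<lambda>\<omega>. B t \<omega> $ i)" by simp
  thus "(\<lambda>\<omega>. B t \<omega> $ i) \<in> borel_measurable M" by (simp add: gaussian_rv_def)
qed

text \<open>Independence of the components factors the characteristic function. Each component
  contributes a centred Gaussian with variance proportional to
  \<open>(a $ i)\<^sup>2 * energy H zs\<close>, and summing over i produces the squared norm of
  a.\<close>

lemma fbm_char:
  fixes B :: "real \<Rightarrow> 'a \<Rightarrow> real ^ 'n"
  assumes M: "prob_space M" and H: "0 < H" "H < 1" and fbm: "fractional_brownian_motion M H B"
  obtains \<kappa> where "0 < \<kappa>"
    "\<And>a zs. (\<And>e r. (e, r) \<in> set zs \<Longrightarrow> 0 \<le> r) \<Longrightarrow>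
      (CLINT \<omega>|M. iexp (lin_comb (\<lambda>r. a \<bullet> B r \<omega>) zs)) = exp (- \<kappa> * (norm a)\<^sup>2 * energy H zs)"
proof -
  interpret prob_space M by fact
  have ind: "indep_vars (\<lambda>_. path_space) (component_path B) UNIV"
    and gp: "\<And>i. gaussian_process M {0..} (\<lambda>t \<omega>. B t \<omega> $ i)"
    and mean: "\<And>i t. 0 \<le> t \<Longrightarrow> (\<integral>\<omega>. B t \<omega> $ i \<partial>M) = 0"
    using fbm by (auto simp: fractional_brownian_motion_def)
  obtain c where c: "0 < c" and cov: "\<And>i s t. 0 \<le> s \<Longrightarrow> 0 \<le> t \<Longrightarrow>
        covariance M (\<lambda>\<omega>. B s \<omega> $ i) (\<lambda>\<omega>. B t \<omega> $ i)
          = c * (t powr (2 * H) + s powr (2 * H) - \<bar>t - s\<bar> powr (2 * H))"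
    using fbm by (auto simp: fractional_brownian_motion_def)
  note meas = fbm_measurable[OF fbm]
  have sq: "integrable M (\<lambda>\<omega>. (B t \<omega> $ i)\<^sup>2)" if "0 \<le> t" for i t
    using gaussian_rv_square_integrable[OF M meas(2)[OF that]] .
  have mean0: "has_bochner_integral M (\<lambda>\<omega>. B t \<omega> $ i) 0" if "0 \<le> t" for i t
    using integrable_mult_of_square[of _ M "\<lambda>_. 1", OF meas(1)[OF that] _ sq[OF that]] mean[OF that]
    by (simp add: has_bochner_integral_iff)
  \<comment> \<open>The ratio between the constant c of the covariance and the constant
    \<open>mvn_const H / 2\<close> of the kernels.\<close>
  define \<kappa> where "\<kappa> = 2 * c / mvn_const H"
  have \<kappa>: "0 < \<kappa>" using c mvn_const_pos[OF H] by (simp add: \<kappa>_def)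
  define k where "k s t = mvn_const H / 2 * (t powr (2 * H) + s powr (2 * H) - \<bar>t - s\<bar> powr (2 * H))" for s t
  have cov': "has_bochner_integral M (\<lambda>\<omega>. B s \<omega> $ i * B t \<omega> $ i) (\<kappa> * k s t)" if "0 \<le> s" "0 \<le> t" for i s t
  proof -
    have "\<kappa> * k s t = c * (t powr (2 * H) + s powr (2 * H) - \<bar>t - s\<bar> powr (2 * H))"
      using mvn_const_pos[OF H] by (simp add: \<kappa>_def k_def)
    thus ?thesis
      using cov[OF that, of i] mean[of s i] mean[of t i] that
        integrable_mult_of_square[OF meas(1) meas(1) sq sq, OF that that]
      by (simp add: has_bochner_integral_iff covariance_def)
  qed
  show thesis
  proof (rule that)
    \<comment> \<open>The half comes from the Gaussian characteristic function, the exponential of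
      minus half the variance.\<close>
    show "0 < \<kappa> / 2" using \<kappa> by simp
    fix a :: "real ^ 'n" and zs :: "(real \<times> real) list"
    assume zs: "\<And>e r. (e, r) \<in> set zs \<Longrightarrow> 0 \<le> r"
    hence zs': "0 \<le> s" if "s \<in> snd ` set zs" for s using that by auto
    define Y where "Y i \<omega> = a $ i * lin_comb (\<lambda>r. B r \<omega> $ i) zs" for i \<omega>
    let ?S = "\<Sum>i<length zs. \<Sum>j<length zs. fst (zs ! i) * fst (zs ! j) * k (snd (zs ! i)) (snd (zs ! j))"
    have en: "energy H zs = ?S"
      unfolding energy_def
      by (rule has_bochner_integral_integral_eq, rule lin_comb_square_integral)
        (unfold k_def, intro integral_mvn_kernel_mult H zs')
    have var: "(\<integral>\<omega>. (lin_comb (\<lambda>r. B r \<omega> $ i) zs)\<^sup>2 \<partial>M) = \<kappa> * energy H zs" for i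
    proof -
      have "(\<integral>\<omega>. (lin_comb (\<lambda>r. B r \<omega> $ i) zs)\<^sup>2 \<partial>M)
          = (\<Sum>i<length zs. \<Sum>j<length zs. fst (zs ! i) * fst (zs ! j) * (\<kappa> * k (snd (zs ! i)) (snd (zs ! j))))"
        by (rule has_bochner_integral_integral_eq, rule lin_comb_square_integral) (intro cov' zs')
      thus ?thesis by (simp add: en sum_distrib_left mult_ac)
    qed
    have g: "gaussian_rv M (Y i)" for i
      unfolding Y_def using zs by (intro gaussian_process_lin_comb gp)
    have Y0: "(\<integral>\<omega>. Y i \<omega> \<partial>M) = 0" for i
      using lin_comb_integral_zero[of zs M "\<lambda>r \<omega>. B r \<omega> $ i"] mean0 zs
      by (simp add: Y_def has_bochner_integral_iff)
    have Yc: "char (distr M borel (Y i)) 1 = exp (- \<kappa> / 2 * (a $ i)\<^sup>2 * energy H zs)" for i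
      using gaussian_rv_char[OF M g Y0, of i] by (simp add: Y_def[abs_def] power_mult_distrib var mult_ac)
    \<comment> \<open>Independence is given for whole paths. Each combination is a measurable
      function of one path, and the restriction to nonnegative times built into
      \<open>component_path\<close> is harmless because all times in \<open>zs\<close> are
      nonnegative.\<close>
    have "indep_vars (\<lambda>_. borel) (\<lambda>i \<omega>. a $ i * lin_comb (component_path B i \<omega>) zs) UNIV"
    proof (rule indep_vars_compose2[OF ind])
      fix i
      have "(\<lambda>f. lin_comb (\<lambda>r. f r) zs) \<in> borel_measurable path_space"
        using zs by (intro lin_comb_measurable) (auto simp: path_space_def intro!: measurable_component_singleton)
      thus "(\<lambda>f. a $ i * lin_comb f zs) \<in> borel_measurable path_space" by simp
    qed
    moreover have "lin_comb (component_path B i \<omega>) zs = lin_comb (\<lambda>r. B r \<omega> $ i) zs" for i \<omega>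
      using zs by (auto simp: lin_comb_def component_path_def intro!: arg_cong[of _ _ sum_list])
    ultimately have "indep_vars (\<lambda>_. borel) Y UNIV" by (simp add: Y_def[abs_def])
    hence "char (distr M borel (\<lambda>\<omega>. \<Sum>i\<in>UNIV. Y i \<omega>)) 1 = (\<Prod>i\<in>UNIV. char (distr M borel (Y i)) 1)"
      by (rule char_distr_sum)
    also have "\<dots> = complex_of_real (exp (\<Sum>i\<in>UNIV. - \<kappa> / 2 * (a $ i)\<^sup>2 * energy H zs))"
      by (simp add: Yc exp_sum)
    also have "(\<Sum>i\<in>UNIV. - \<kappa> / 2 * (a $ i)\<^sup>2 * energy H zs) = - (\<kappa> / 2) * (norm a)\<^sup>2 * energy H zs"
    proof -
      have "(norm a)\<^sup>2 = (\<Sum>i\<in>UNIV. (a $ i)\<^sup>2)"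
        unfolding power2_norm_eq_inner inner_vec_def by (simp add: power2_eq_square)
      thus ?thesis by (simp only: sum_distrib_left sum_distrib_right minus_divide_left)
    qed
    finally have "char (distr M borel (\<lambda>\<omega>. \<Sum>i\<in>UNIV. Y i \<omega>)) 1 = exp (- (\<kappa> / 2) * (norm a)\<^sup>2 * energy H zs)" .
    moreover have "(\<lambda>\<omega>. \<Sum>i\<in>UNIV. Y i \<omega>) \<in> borel_measurable M"
      using g by (intro borel_measurable_sum) (simp add: gaussian_rv_def)
    ultimately show "(CLINT \<omega>|M. iexp (lin_comb (\<lambda>r. a \<bullet> B r \<omega>) zs)) = exp (- (\<kappa> / 2) * (norm a)\<^sup>2 * energy H zs)"
      by (simp add: char_def integral_distr lin_comb_inner Y_def[symmetric])
  qed
qed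

section \<open>Moments of exponential sums\<close>

fun pair_prod :: "('b \<Rightarrow> 'b \<Rightarrow> 'c :: comm_semiring_1) \<Rightarrow> 'b list \<Rightarrow> 'c" where
  "pair_prod h (u # v # xs) = h u v * pair_prod h xs"
| "pair_prod h xs = 1"

abbreviation lists_of_length :: "'b set \<Rightarrow> nat \<Rightarrow> 'b list set" where
  "lists_of_length A n \<equiv> {xs. set xs \<subseteq> A \<and> length xs = n}"

lemma sum_lists_Suc:
  "(\<Sum>xs\<in>lists_of_length A (Suc n). f xs) = (\<Sum>u\<in>A. \<Sum>xs\<in>lists_of_length A n. f (u # xs))"
proof -
  have "(\<Sum>xs\<in>lists_of_length A (Suc n). f xs) = (\<Sum>(xs, u)\<in>lists_of_length A n \<times> A. f (u # xs))"
    unfolding lists_length_Suc_eq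
    by (subst sum.reindex) (simp_all add: inj_on_def case_prod_unfold o_def)
  also have "\<dots> = (\<Sum>xs\<in>lists_of_length A n. \<Sum>u\<in>A. f (u # xs))"
    by (rule sum.cartesian_product[symmetric])
  also have "\<dots> = (\<Sum>u\<in>A. \<Sum>xs\<in>lists_of_length A n. f (u # xs))"
    by (rule sum.swap)
  finally show ?thesis .
qed

text \<open>Needed in both directions: to expand a power of the squared modulus into a sum over
  lists of times, and to fold the bound over lists back into the power of a double sum.\<close>

lemma sum_pair_prod:
  "(\<Sum>xs\<in>lists_of_length A (2 * p). pair_prod h xs) = (\<Sum>u\<in>A. \<Sum>v\<in>A. h u v) ^ p"
proof (induction p)
  case 0
  have "lists_of_length A (2 * 0) = {[]}" by auto
  thus ?case by simp
next
  case (Suc p)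
  have "(\<Sum>xs\<in>lists_of_length A (2 * Suc p). pair_prod h xs)
      = (\<Sum>u\<in>A. \<Sum>v\<in>A. \<Sum>xs\<in>lists_of_length A (2 * p). h u v * pair_prod h xs)"
    by (simp only: mult_Suc_right numeral_2_eq_2 add_Suc add_0 sum_lists_Suc pair_prod.simps)
  also have "\<dots> = (\<Sum>u\<in>A. \<Sum>v\<in>A. h u v * (\<Sum>u\<in>A. \<Sum>v\<in>A. h u v) ^ p)"
    by (simp only: sum_distrib_left[symmetric] Suc.IH)
  finally show ?case by (simp add: sum_distrib_right)
qed

text \<open>A given list is the sorted form of at most n! lists, since these are all permutations of
  one multiset.\<close>

lemma sum_lists_rev_sort_le:
  fixes f :: "'b :: linorder list \<Rightarrow> real"
  assumes A: "finite A" and f: "\<And>xs. 0 \<le> f xs"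
  shows "(\<Sum>xs\<in>lists_of_length A n. f (rev (sort xs))) \<le> fact n * (\<Sum>xs\<in>lists_of_length A n. f xs)"
proof -
  let ?L = "lists_of_length A n" and ?g = "\<lambda>xs :: 'b list. rev (sort xs)"
  have fin: "finite ?L" using A by (rule finite_lists_length_eq)
  have "(\<Sum>xs\<in>?L. f (?g xs)) = (\<Sum>ys\<in>?L. \<Sum>xs\<in>{xs\<in>?L. ?g xs = ys}. f (?g xs))"
    by (rule sum.group[symmetric]) (use fin in auto)
  also have "\<dots> = (\<Sum>ys\<in>?L. card {xs\<in>?L. ?g xs = ys} * f ys)"
    by (intro sum.cong) auto
  also have "\<dots> \<le> (\<Sum>ys\<in>?L. fact n * f ys)"
  proof (intro sum_mono mult_right_mono f)
    fix ys assume ys: "ys \<in> ?L"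
    have "card {xs\<in>?L. ?g xs = ys} \<le> card (permutations_of_multiset (mset ys))"
      by (intro card_mono) (auto intro!: permutations_of_multisetI)
    also have "\<dots> \<le> fact n"
    proof -
      have "card (permutations_of_multiset (mset ys)) dvd fact (size (mset ys))"
        using card_permutations_of_multiset_aux[of "mset ys"] by (metis dvd_triv_left)
      thus ?thesis using ys by (intro dvd_imp_le) auto
    qed
    finally have "real (card {xs\<in>?L. ?g xs = ys}) \<le> real (fact n)" by (rule of_nat_mono)
    thus "real (card {xs\<in>?L. ?g xs = ys}) \<le> fact n" by simp
  qed
  finally show ?thesis by (simp add: sum_distrib_left)
qed

text \<open>These are the signs with which the times enter the phase when S times its conjugate,
  raised to the power p, is expanded: plus from S, minus from the conjugate.\<close>

fun alt_signs :: "real list \<Rightarrow> (real \<times> real) list" where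
  "alt_signs (u # v # xs) = (1, u) # (-1, v) # alt_signs xs"
| "alt_signs xs = []"

lemma map_snd_alt_signs: "even (length xs) \<Longrightarrow> map snd (alt_signs xs) = xs"
  by (induction xs rule: alt_signs.induct) auto

lemma fst_alt_signs: "(e, r) \<in> set (alt_signs xs) \<Longrightarrow> e = 1 \<or> e = -1"
  by (induction xs rule: alt_signs.induct) auto

lemma pair_prod_iexp:
  "pair_prod (\<lambda>u v. iexp (f u) * cnj (iexp (f v))) xs = iexp (lin_comb f (alt_signs xs))"
proof (induction xs rule: alt_signs.induct)
  case (1 u v xs)
  have "iexp (f u) * iexp (- f v) * iexp (lin_comb f (alt_signs xs)) = iexp (lin_comb f (alt_signs (u # v # xs)))"
    by (simp add: mult_exp_exp algebra_simps)
  moreover have "cnj (iexp (f v)) = iexp (- f v)" by (simp add: exp_cnj)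
  ultimately show ?case by (simp only: pair_prod.simps 1)
qed simp_all

lemma exp_pair_sum: "exp (- (b * pair_sum d xs)) = pair_prod (\<lambda>u v. exp (- (b * d u v))) xs"
proof (induction d xs rule: pair_sum.induct)
  case (1 d u v xs)
  show ?case
    by (simp only: pair_sum.simps pair_prod.simps distrib_left minus_add_distrib exp_add 1)
qed simp_all

lemma energy_mset: "mset zs = mset zs' \<Longrightarrow> energy H zs = energy H zs'"
  unfolding energy_def by (simp add: lin_comb_mset[of zs zs'])

text \<open>Sorting by time carries the signs along and leaves the energy unchanged. It destroys the
  alternation, which is why \<open>energy_pairs_lower\<close> admits every pattern of signs.\<close>

lemma energy_alt_signs_lower:
  assumes H: "0 < H" "H < 1" and xs: "even (length xs)" "set xs \<subseteq> {0..}"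
  shows "lnd_const H ^ length xs * pair_sum (\<lambda>u v. \<bar>u - v\<bar> powr (2 * H)) (rev (sort xs)) \<le> energy H (alt_signs xs)"
proof -
  define zs where "zs = rev (sort_key snd (alt_signs xs))"
  have m: "mset zs = mset (alt_signs xs)" by (simp add: zs_def)
  have s: "map snd (sort_key snd (alt_signs xs)) = sort xs"
  proof (rule properties_for_sort[symmetric])
    have "mset (map snd (sort_key snd (alt_signs xs))) = mset (map snd (alt_signs xs))" by simp
    thus "mset (map snd (sort_key snd (alt_signs xs))) = mset xs"
      by (simp only: map_snd_alt_signs[OF xs(1)])
  qed simp
  have zs: "map snd zs = rev (sort xs)" by (simp add: zs_def s rev_map[symmetric])
  have len: "length zs = length xs" using arg_cong[OF zs, of length] by simp
  have "sorted_wrt (\<ge>) (map snd zs)" by (simp add: zs sorted_wrt_rev)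
  moreover have "(e = 1 \<or> e = -1) \<and> 0 \<le> r" if "(e, r) \<in> set zs" for e r
  proof -
    have "(e, r) \<in> set (alt_signs xs)" using that by (metis m set_mset_mset)
    moreover from this have "r \<in> set (map snd (alt_signs xs))" by force
    ultimately show ?thesis using fst_alt_signs[of e r xs] xs map_snd_alt_signs[OF xs(1)] by auto
  qed
  ultimately have "lnd_const H ^ length zs * pair_sum (\<lambda>u v. \<bar>u - v\<bar> powr (2 * H)) (map snd zs) \<le> energy H zs"
    by (rule energy_pairs_lower[OF H])
  thus ?thesis by (simp add: zs len energy_mset[OF m])
qed

lemma fbm_exp_sum_moment:
  fixes B :: "real \<Rightarrow> 'a \<Rightarrow> real ^ 'n"
  assumes M: "prob_space M" and H: "0 < H" "H < 1" and fbm: "fractional_brownian_motion M H B"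
  obtains \<beta> where "0 < \<beta>"
    "\<And>a A. finite A \<Longrightarrow> A \<subseteq> {0..} \<Longrightarrow>
      integrable M (\<lambda>\<omega>. norm (\<Sum>r\<in>A. iexp (a \<bullet> B r \<omega>)) ^ (2 * p)) \<and>
      (\<integral>\<omega>. norm (\<Sum>r\<in>A. iexp (a \<bullet> B r \<omega>)) ^ (2 * p) \<partial>M)
        \<le> fact (2 * p) * (\<Sum>u\<in>A. \<Sum>v\<in>A. exp (- (\<beta> * (norm a)\<^sup>2 * \<bar>u - v\<bar> powr (2 * H)))) ^ p"
proof -
  interpret prob_space M by fact
  obtain \<kappa> where \<kappa>: "0 < \<kappa>" and char: "\<And>a zs. (\<And>e r. (e, r) \<in> set zs \<Longrightarrow> 0 \<le> r) \<Longrightarrow>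
      (CLINT \<omega>|M. iexp (lin_comb (\<lambda>r. a \<bullet> B r \<omega>) zs)) = exp (- \<kappa> * (norm a)\<^sup>2 * energy H zs)"
    using fbm_char[OF M H fbm] by blast
  \<comment> \<open>All lists in the expansion have length 2p, so the local nondeterminism constant
    is the same for each of them. It depends on p, but neither on the frequency nor on the set of
    times.\<close>
  define \<beta> where "\<beta> = \<kappa> * lnd_const H ^ (2 * p)"
  show thesis
  proof (rule that)
    show "0 < \<beta>" using \<kappa> lnd_const_bounds[OF H] by (simp add: \<beta>_def)
    fix a :: "real ^ 'n" and A :: "real set"
    assume A: "finite A" "A \<subseteq> {0..}"
    let ?L = "lists_of_length A (2 * p)"
    let ?S = "\<lambda>\<omega>. \<Sum>r\<in>A. iexp (a \<bullet> B r \<omega>)"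
    have nonneg: "0 \<le> r" if "xs \<in> ?L" "(e, r) \<in> set (alt_signs xs)" for xs e r
    proof -
      have "r \<in> set (map snd (alt_signs xs))" using that(2) by force
      hence "r \<in> set xs" using that(1) by (subst (asm) map_snd_alt_signs) auto
      thus ?thesis using that A by auto
    qed
    have [measurable]: "(\<lambda>\<omega>. B r \<omega> $ i) \<in> borel_measurable M" if "0 \<le> r" for r i
      using fbm_measurable(1)[OF fbm that] .
    have ab [measurable]: "(\<lambda>\<omega>. a \<bullet> B r \<omega>) \<in> borel_measurable M" if "0 \<le> r" for r
      using that unfolding inner_vec_def by simp
    have expand: "complex_of_real (norm (?S \<omega>) ^ (2 * p))
        = (\<Sum>xs\<in>?L. iexp (lin_comb (\<lambda>r. a \<bullet> B r \<omega>) (alt_signs xs)))" for \<omega>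
    proof -
      have "complex_of_real (norm (?S \<omega>) ^ (2 * p)) = (complex_of_real (norm (?S \<omega>) ^ 2)) ^ p"
        by (simp add: power_mult)
      also have "\<dots> = (?S \<omega> * cnj (?S \<omega>)) ^ p"
        by (simp only: complex_norm_square)
      also have "?S \<omega> * cnj (?S \<omega>) = (\<Sum>u\<in>A. \<Sum>v\<in>A. iexp (a \<bullet> B u \<omega>) * cnj (iexp (a \<bullet> B v \<omega>)))"
        by (simp only: cnj_sum sum_product)
      also have "\<dots> ^ p = (\<Sum>xs\<in>?L. pair_prod (\<lambda>u v. iexp (a \<bullet> B u \<omega>) * cnj (iexp (a \<bullet> B v \<omega>))) xs)"
        by (rule sum_pair_prod[symmetric])
      finally show ?thesis by (simp only: pair_prod_iexp)
    qed
    have int: "integrable M (\<lambda>\<omega>. iexp (lin_comb (\<lambda>r. a \<bullet> B r \<omega>) (alt_signs xs)))" if "xs \<in> ?L" for xs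
    proof (rule integrable_const_bound[where B = 1])
      have [measurable]: "(\<lambda>\<omega>. lin_comb (\<lambda>r. a \<bullet> B r \<omega>) (alt_signs xs)) \<in> borel_measurable M"
        using nonneg[OF that] by (intro lin_comb_measurable ab)
      show "(\<lambda>\<omega>. iexp (lin_comb (\<lambda>r. a \<bullet> B r \<omega>) (alt_signs xs))) \<in> borel_measurable M" by measurable
    qed simp
    have "integrable M (\<lambda>\<omega>. complex_of_real (norm (?S \<omega>) ^ (2 * p)))"
      unfolding expand by (intro Bochner_Integration.integrable_sum int)
    hence I: "integrable M (\<lambda>\<omega>. norm (?S \<omega>) ^ (2 * p))"
      by (simp only: complex_of_real_integrable_eq)
    have "complex_of_real (\<integral>\<omega>. norm (?S \<omega>) ^ (2 * p) \<partial>M) = (CLINT \<omega>|M. complex_of_real (norm (?S \<omega>) ^ (2 * p)))"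
      by (rule integral_complex_of_real[symmetric])
    also have "\<dots> = (\<Sum>xs\<in>?L. CLINT \<omega>|M. iexp (lin_comb (\<lambda>r. a \<bullet> B r \<omega>) (alt_signs xs)))"
      unfolding expand by (intro Bochner_Integration.integral_sum int)
    also have "\<dots> = (\<Sum>xs\<in>?L. complex_of_real (exp (- \<kappa> * (norm a)\<^sup>2 * energy H (alt_signs xs))))"
      using nonneg by (intro sum.cong char) auto
    also have "\<dots> = complex_of_real (\<Sum>xs\<in>?L. exp (- \<kappa> * (norm a)\<^sup>2 * energy H (alt_signs xs)))"
      by simp
    finally have "(\<integral>\<omega>. norm (?S \<omega>) ^ (2 * p) \<partial>M) = (\<Sum>xs\<in>?L. exp (- \<kappa> * (norm a)\<^sup>2 * energy H (alt_signs xs)))"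
      by (simp only: of_real_eq_iff)
    also have "\<dots> \<le> (\<Sum>xs\<in>?L. exp (- (\<beta> * (norm a)\<^sup>2 * pair_sum (\<lambda>u v. \<bar>u - v\<bar> powr (2 * H)) (rev (sort xs)))))"
    proof (intro sum_mono)
      fix xs assume xs: "xs \<in> ?L"
      have "\<kappa> * (norm a)\<^sup>2 * (lnd_const H ^ length xs * pair_sum (\<lambda>u v. \<bar>u - v\<bar> powr (2 * H)) (rev (sort xs)))
          \<le> \<kappa> * (norm a)\<^sup>2 * energy H (alt_signs xs)"
        using xs A \<kappa> by (intro mult_left_mono energy_alt_signs_lower H) auto
      thus "exp (- \<kappa> * (norm a)\<^sup>2 * energy H (alt_signs xs))
          \<le> exp (- (\<beta> * (norm a)\<^sup>2 * pair_sum (\<lambda>u v. \<bar>u - v\<bar> powr (2 * H)) (rev (sort xs))))"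
        using xs by (simp add: \<beta>_def mult_ac)
    qed
    \<comment> \<open>The bound now factors over pairs, but of the sorted list. Dropping the sorting
      costs the factorial, after which the sum over lists is a p-th power.\<close>
    also have "\<dots> = (\<Sum>xs\<in>?L. pair_prod (\<lambda>u v. exp (- (\<beta> * (norm a)\<^sup>2 * \<bar>u - v\<bar> powr (2 * H)))) (rev (sort xs)))"
      by (simp only: exp_pair_sum)
    also have "\<dots> \<le> fact (2 * p) * (\<Sum>xs\<in>?L. pair_prod (\<lambda>u v. exp (- (\<beta> * (norm a)\<^sup>2 * \<bar>u - v\<bar> powr (2 * H)))) xs)"
    proof (rule sum_lists_rev_sort_le[OF A(1)])
      show "0 \<le> pair_prod (\<lambda>u v. exp (- (\<beta> * (norm a)\<^sup>2 * \<bar>u - v\<bar> powr (2 * H)))) xs" for xs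
        unfolding exp_pair_sum[symmetric] by simp
    qed
    finally show "integrable M (\<lambda>\<omega>. norm (?S \<omega>) ^ (2 * p)) \<and>
      (\<integral>\<omega>. norm (?S \<omega>) ^ (2 * p) \<partial>M)
        \<le> fact (2 * p) * (\<Sum>u\<in>A. \<Sum>v\<in>A. exp (- (\<beta> * (norm a)\<^sup>2 * \<bar>u - v\<bar> powr (2 * H)))) ^ p"
      using I by (simp only: sum_pair_prod)
  qed
qed

section \<open>Moments of the occupation integral\<close>

text \<open>Uniform continuity bounds the error on each cell. The lemma presents increments of
  \<open>Phi\<close> as limits of finite exponential sums, whose moments are already
  bounded.\<close>

lemma riemann_sum_tendsto_integral:
  fixes f :: "real \<Rightarrow> complex"
  assumes st: "s \<le> t" and f: "continuous_on {s..t} f"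
  shows "(\<lambda>n. of_real ((t - s) / real (Suc n)) * (\<Sum>j<Suc n. f (s + (t - s) / real (Suc n) * real j)))
           \<longlonglongrightarrow> integral {s..t} f"
proof (rule LIMSEQ_I)
  fix \<epsilon> :: real assume \<epsilon>: "0 < \<epsilon>"
  \<comment> \<open>The added 1 keeps the divisor positive when s = t.\<close>
  define u where "u = t - s + 1"
  have u: "0 < u" "t - s \<le> u" using st by (simp_all add: u_def)
  define e where "e = \<epsilon> / 2 / u"
  have e: "0 < e" "e * (t - s) < \<epsilon>"
  proof -
    show "0 < e" using \<epsilon> u by (simp add: e_def)
    hence "e * (t - s) \<le> e * u" using u by (intro mult_left_mono) auto
    also have "\<dots> = \<epsilon> / 2" using u by (simp add: e_def)
    finally show "e * (t - s) < \<epsilon>" using \<epsilon> by simp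
  qed
  have "uniformly_continuous_on {s..t} f"
    using f by (rule compact_uniformly_continuous) simp
  then obtain d where d: "0 < d" "\<And>x y. x \<in> {s..t} \<Longrightarrow> y \<in> {s..t} \<Longrightarrow> dist y x < d \<Longrightarrow> dist (f y) (f x) < e"
    using e(1) unfolding uniformly_continuous_on_def by blast
  obtain n0 where n0: "(t - s) / d < real n0" using reals_Archimedean2 by blast
  have "norm (of_real ((t - s) / real (Suc n)) * (\<Sum>j<Suc n. f (s + (t - s) / real (Suc n) * real j)) - integral {s..t} f) < \<epsilon>"
    if n: "n \<ge> n0" for n
  proof -
    define \<Delta> where "\<Delta> = (t - s) / real (Suc n)"
    define x where "x j = s + \<Delta> * real j" for j
    have \<Delta>: "0 \<le> \<Delta>" "\<Delta> < d" "\<Delta> * real (Suc n) = t - s"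
    proof -
      show "0 \<le> \<Delta>" "\<Delta> * real (Suc n) = t - s" using st by (auto simp: \<Delta>_def)
      have "(t - s) / d < real (Suc n)" using n0 n by linarith
      thus "\<Delta> < d" using d(1) by (simp add: \<Delta>_def field_simps)
    qed
    have x: "x j \<in> {s..t}" if "j \<le> Suc n" for j
    proof -
      have "\<Delta> * real j \<le> \<Delta> * real (Suc n)" using \<Delta>(1) that by (intro mult_left_mono) auto
      thus ?thesis using \<Delta> by (simp add: x_def)
    qed
    have xS: "x (Suc j) = x j + \<Delta>" for j by (simp add: x_def algebra_simps)
    have int: "f integrable_on {a..b}" if "s \<le> a" "b \<le> t" for a b
      using f that by (intro integrable_continuous_real continuous_on_subset[OF f]) auto
    have split: "integral {s..x k} f = (\<Sum>j<k. integral {x j..x (Suc j)} f)" if "k \<le> Suc n" for k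
      using that
    proof (induction k)
      case 0
      show ?case by (simp add: x_def)
    next
      case (Suc k)
      have "integral {s..x k} f + integral {x k..x (Suc k)} f = integral {s..x (Suc k)} f"
        using x[of k] x[of "Suc k"] xS[of k] \<Delta>(1) Suc.prems
        by (intro Henstock_Kurzweil_Integration.integral_combine int) auto
      thus ?case using Suc by simp
    qed
    have "x (Suc n) = t" using \<Delta>(3) by (simp add: x_def)
    hence "of_real \<Delta> * (\<Sum>j<Suc n. f (x j)) - integral {s..t} f
        = (\<Sum>j<Suc n. of_real \<Delta> * f (x j) - integral {x j..x (Suc j)} f)"
      using split[of "Suc n"] by (simp only: sum_subtractf sum_distrib_left order_refl)
    also have "norm \<dots> \<le> (\<Sum>j<Suc n. e * \<Delta>)"
    proof (rule sum_norm_le)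
      fix j assume j: "j \<in> {..<Suc n}"
      have xj: "x j \<in> {s..t}" "x (Suc j) \<in> {s..t}" using x[of j] x[of "Suc j"] j by auto
      have i: "f integrable_on {x j..x (Suc j)}" using xj by (intro int) auto
      have "((\<lambda>y. f y - f (x j)) has_integral (integral {x j..x (Suc j)} f - (x (Suc j) - x j) *\<^sub>R f (x j))) (cbox (x j) (x (Suc j)))"
        using has_integral_diff[OF integrable_integral[OF i] has_integral_const_real[of "f (x j)" "x j" "x (Suc j)"]]
          xS[of j] \<Delta>(1) by simp
      hence "norm (integral {x j..x (Suc j)} f - (x (Suc j) - x j) *\<^sub>R f (x j)) \<le> e * measure lborel (cbox (x j) (x (Suc j)))"
      proof (rule has_integral_bound[rotated])
        fix y assume "y \<in> cbox (x j) (x (Suc j))"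
        thus "norm (f y - f (x j)) \<le> e"
          using d(2)[of "x j" y] xj xS[of j] \<Delta> by (auto simp: dist_norm)
      qed (use e in auto)
      thus "norm (of_real \<Delta> * f (x j) - integral {x j..x (Suc j)} f) \<le> e * \<Delta>"
        using xS[of j] \<Delta>(1) by (simp add: norm_minus_commute scaleR_conv_of_real)
    qed
    also have "(\<Sum>j<Suc n. e * \<Delta>) = e * (t - s)"
      unfolding \<Delta>(3)[symmetric] by (simp add: algebra_simps)
    finally show ?thesis using e by (simp add: \<Delta>_def x_def)
  qed
  thus "\<exists>no. \<forall>n\<ge>no. norm (of_real ((t - s) / real (Suc n)) * (\<Sum>j<Suc n. f (s + (t - s) / real (Suc n) * real j)) - integral {s..t} f) < \<epsilon>"
    by blast
qed

lemma card_nat_close_le: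
  assumes "0 \<le> q"
  shows "real (card {j \<in> {..<n}. \<bar>real i - real j\<bar> \<le> q}) \<le> 2 * q + 1"
proof -
  let ?S = "{j \<in> {..<n}. \<bar>real i - real j\<bar> \<le> q}"
  have "card ?S = card (int ` ?S)" by (simp add: card_image)
  also have "\<dots> \<le> card {\<lceil>real i - q\<rceil>..\<lfloor>real i + q\<rfloor>}"
  proof (intro card_mono subsetI)
    fix m assume "m \<in> int ` ?S"
    then obtain j where j: "real_of_int m = real j" "\<bar>real i - real j\<bar> \<le> q" by auto
    have "\<lceil>real i - q\<rceil> \<le> m" using j by (subst ceiling_le_iff) linarith
    moreover have "m \<le> \<lfloor>real i + q\<rfloor>" using j by (subst le_floor_iff) linarith
    ultimately show "m \<in> {\<lceil>real i - q\<rceil>..\<lfloor>real i + q\<rfloor>}" by simp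
  qed simp
  also have "\<dots> = nat (\<lfloor>real i + q\<rfloor> - \<lceil>real i - q\<rceil> + 1)" by simp
  finally have "real (card ?S) \<le> real (nat (\<lfloor>real i + q\<rfloor> - \<lceil>real i - q\<rceil> + 1))" by simp
  also have "\<dots> \<le> 2 * q + 1"
    using assms by (simp add: of_nat_nat) linarith
  finally show ?thesis .
qed

text \<open>The terms with \<open>\<bar>i - j\<bar> \<Delta> \<le> L\<close> are bounded by 1, the others by \<open>exp (- b L powr (2 H))\<close>.\<close>

lemma sum_exp_grid_le:
  fixes b H \<Delta> L :: real
  assumes "0 < H" "0 \<le> b" "0 < \<Delta>" "0 < L"
  shows "\<Delta>\<^sup>2 * (\<Sum>i<n. \<Sum>j<n. exp (- (b * \<bar>\<Delta> * real i - \<Delta> * real j\<bar> powr (2 * H))))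
    \<le> (\<Delta> * real n) * (2 * L + \<Delta> + (\<Delta> * real n) * exp (- (b * L powr (2 * H))))"
proof -
  \<comment> \<open>The cut-off L measured in grid steps; a row has at most 2q + 1 indices within
    this distance.\<close>
  define q where "q = L / \<Delta>"
  have q: "0 \<le> q" "\<Delta> * q = L" using assms by (auto simp: q_def)
  have row: "(\<Sum>j<n. exp (- (b * \<bar>\<Delta> * real i - \<Delta> * real j\<bar> powr (2 * H))))
      \<le> 2 * q + 1 + real n * exp (- (b * L powr (2 * H)))" for i
  proof -
    have "(\<Sum>j<n. exp (- (b * \<bar>\<Delta> * real i - \<Delta> * real j\<bar> powr (2 * H))))
        \<le> (\<Sum>j<n. (if \<bar>real i - real j\<bar> \<le> q then 1 else 0) + exp (- (b * L powr (2 * H))))"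
    proof (intro sum_mono)
      fix j
      have eq: "\<bar>\<Delta> * real i - \<Delta> * real j\<bar> = \<Delta> * \<bar>real i - real j\<bar>"
        using assms by (simp add: abs_mult flip: right_diff_distrib)
      show "exp (- (b * \<bar>\<Delta> * real i - \<Delta> * real j\<bar> powr (2 * H)))
          \<le> (if \<bar>real i - real j\<bar> \<le> q then 1 else 0) + exp (- (b * L powr (2 * H)))"
      proof (cases "\<bar>real i - real j\<bar> \<le> q")
        case True
        have "exp (- (b * \<bar>\<Delta> * real i - \<Delta> * real j\<bar> powr (2 * H))) \<le> 1"
          using assms by simp
        thus ?thesis using True by (simp add: add_increasing2)
      next
        case False
        hence "L \<le> \<Delta> * \<bar>real i - real j\<bar>" using q assms by (metis linorder_linear mult_left_mono less_imp_le)
        hence "L powr (2 * H) \<le> (\<Delta> * \<bar>real i - real j\<bar>) powr (2 * H)"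
          using assms by (intro powr_mono2) auto
        thus ?thesis using False assms by (simp add: eq mult_left_mono)
      qed
    qed
    also have "\<dots> = real (card {j \<in> {..<n}. \<bar>real i - real j\<bar> \<le> q}) + real n * exp (- (b * L powr (2 * H)))"
      by (simp add: sum.distrib sum.If_cases Int_def)
    also have "\<dots> \<le> 2 * q + 1 + real n * exp (- (b * L powr (2 * H)))"
      using card_nat_close_le[OF q(1), of n i] by simp
    finally show ?thesis .
  qed
  have "\<Delta>\<^sup>2 * (\<Sum>i<n. \<Sum>j<n. exp (- (b * \<bar>\<Delta> * real i - \<Delta> * real j\<bar> powr (2 * H))))
      \<le> \<Delta>\<^sup>2 * (\<Sum>i<n. 2 * q + 1 + real n * exp (- (b * L powr (2 * H))))"
    by (intro mult_left_mono sum_mono row) simp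
  also have "\<dots> = (\<Delta> * real n) * (2 * (\<Delta> * q) + \<Delta> + (\<Delta> * real n) * exp (- (b * L powr (2 * H))))"
    by (simp add: power2_eq_square algebra_simps)
  finally show ?thesis by (simp only: q(2))
qed

lemma Phi_diff:
  assumes "continuous_on {0..} w" "0 \<le> s" "s \<le> t"
  shows "Phi w t a - Phi w s a = integral {s..t} (\<lambda>r. iexp (a \<bullet> w r))"
proof -
  have "(\<lambda>r. iexp (a \<bullet> w r)) integrable_on {0..t}"
    using assms by (intro integrable_continuous_real continuous_intros) (auto intro: continuous_on_subset)
  hence "integral {0..s} (\<lambda>r. iexp (a \<bullet> w r)) + integral {s..t} (\<lambda>r. iexp (a \<bullet> w r))
      = integral {0..t} (\<lambda>r. iexp (a \<bullet> w r))"
    using assms by (intro Henstock_Kurzweil_Integration.integral_combine) auto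
  thus ?thesis by (simp add: Phi_def algebra_simps)
qed

lemma fbm_Phi_moment:
  fixes B :: "real \<Rightarrow> 'a \<Rightarrow> real ^ 'n"
  assumes M: "prob_space M" and H: "0 < H" "H < 1" and fbm: "fractional_brownian_motion M H B"
  obtains \<beta> where "0 < \<beta>"
    "\<And>a s t L. 0 \<le> s \<Longrightarrow> s < t \<Longrightarrow> 0 < L \<Longrightarrow>
      \<exists>Z \<in> borel_measurable M.
        (\<forall>\<omega>. continuous_on {0..} (\<lambda>t. B t \<omega>) \<longrightarrow>
          Z \<omega> = ennreal (norm (Phi (\<lambda>t. B t \<omega>) t a - Phi (\<lambda>t. B t \<omega>) s a) ^ (2 * p))) \<and>
        (\<integral>\<^sup>+\<omega>. Z \<omega> \<partial>M) \<le> ennreal (fact (2 * p) *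
          ((t - s) * (2 * L + (t - s) * exp (- (\<beta> * (norm a)\<^sup>2 * L powr (2 * H))))) ^ p)"
proof -
  interpret prob_space M by fact
  obtain \<beta> where \<beta>: "0 < \<beta>" and mom: "\<And>a A. finite A \<Longrightarrow> A \<subseteq> {0..} \<Longrightarrow>
      integrable M (\<lambda>\<omega>. norm (\<Sum>r\<in>A. iexp (a \<bullet> B r \<omega>)) ^ (2 * p)) \<and>
      (\<integral>\<omega>. norm (\<Sum>r\<in>A. iexp (a \<bullet> B r \<omega>)) ^ (2 * p) \<partial>M)
        \<le> fact (2 * p) * (\<Sum>u\<in>A. \<Sum>v\<in>A. exp (- (\<beta> * (norm a)\<^sup>2 * \<bar>u - v\<bar> powr (2 * H)))) ^ p"
    using fbm_exp_sum_moment[OF M H fbm, of p] by blast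
  show thesis
  proof (rule that[OF \<beta>])
    fix a :: "real ^ 'n" and s t L :: real
    assume st: "0 \<le> s" "s < t" and L: "0 < L"
    let ?b = "\<beta> * (norm a)\<^sup>2"
    let ?E = "exp (- (?b * L powr (2 * H)))"
    define \<Delta> where "\<Delta> n = (t - s) / real (Suc n)" for n
    define x where "x n j = s + \<Delta> n * real j" for n j
    define S where "S n \<omega> = of_real (\<Delta> n) * (\<Sum>j<Suc n. iexp (a \<bullet> B (x n j) \<omega>))" for n \<omega>
    \<comment> \<open>A lower limit is measurable without any convergence, and it is the form to
      which Fatou's lemma applies.\<close>
    define Z where "Z \<omega> = liminf (\<lambda>n. ennreal (norm (S n \<omega>) ^ (2 * p)))" for \<omega>
    have \<Delta>: "0 < \<Delta> n" "\<Delta> n * real (Suc n) = t - s" for n using st by (auto simp: \<Delta>_def)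
    \<comment> \<open>The moment bound concerns sets of times, so distinct grid indices must give
      distinct times.\<close>
    have inj: "inj_on (x n) {..<Suc n}" for n using \<Delta>(1)[of n] by (auto simp: inj_on_def x_def)
    have S: "integrable M (\<lambda>\<omega>. norm (S n \<omega>) ^ (2 * p)) \<and>
        (\<integral>\<omega>. norm (S n \<omega>) ^ (2 * p) \<partial>M) \<le> fact (2 * p) * ((t - s) * (2 * L + \<Delta> n + (t - s) * ?E)) ^ p" for n
    proof -
      let ?A = "x n ` {..<Suc n}"
      let ?D = "\<Sum>u\<in>?A. \<Sum>v\<in>?A. exp (- (?b * \<bar>u - v\<bar> powr (2 * H)))"
      have A: "finite ?A" "?A \<subseteq> {0..}" using st \<Delta>(1)[of n] by (auto simp: x_def)
      have eq: "norm (S n \<omega>) ^ (2 * p) = \<Delta> n ^ (2 * p) * norm (\<Sum>r\<in>?A. iexp (a \<bullet> B r \<omega>)) ^ (2 * p)" for \<omega>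
        using \<Delta>(1)[of n] by (simp add: S_def sum.reindex[OF inj] norm_mult power_mult_distrib del: sum.lessThan_Suc)
      have D: "?D = (\<Sum>i<Suc n. \<Sum>j<Suc n. exp (- (?b * \<bar>\<Delta> n * real i - \<Delta> n * real j\<bar> powr (2 * H))))"
        unfolding sum.reindex[OF inj] o_def by (simp add: x_def del: sum.lessThan_Suc)
      have "(\<integral>\<omega>. norm (S n \<omega>) ^ (2 * p) \<partial>M) \<le> \<Delta> n ^ (2 * p) * (fact (2 * p) * ?D ^ p)"
        unfolding eq using mom[OF A, of a] \<Delta>(1)[of n] by (simp add: mult_left_mono)
      also have "\<dots> = fact (2 * p) * ((\<Delta> n)\<^sup>2 * ?D) ^ p"
        by (simp add: power_mult power_mult_distrib)
      also have "\<dots> \<le> fact (2 * p) * ((t - s) * (2 * L + \<Delta> n + (t - s) * ?E)) ^ p"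
        using sum_exp_grid_le[of H ?b "\<Delta> n" L "Suc n"] H \<beta> \<Delta>[of n] L unfolding D
        by (intro mult_left_mono power_mono) (auto simp del: sum.lessThan_Suc of_nat_Suc intro!: sum_nonneg mult_nonneg_nonneg)
      finally show ?thesis unfolding eq using mom[OF A, of a] by auto
    qed
    have "(\<lambda>\<omega>. norm (S n \<omega>) ^ (2 * p)) \<in> borel_measurable M" for n
      using S[of n] by auto
    hence Sm: "(\<lambda>\<omega>. ennreal (norm (S n \<omega>) ^ (2 * p))) \<in> borel_measurable M" for n
      by (rule measurable_compose[OF _ measurable_ennreal])
    have \<Delta>0: "\<Delta> \<longlonglongrightarrow> 0"
      unfolding \<Delta>_def by (rule LIMSEQ_Suc) (rule lim_const_over_n)
    show "\<exists>Z \<in> borel_measurable M.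
        (\<forall>\<omega>. continuous_on {0..} (\<lambda>t. B t \<omega>) \<longrightarrow>
          Z \<omega> = ennreal (norm (Phi (\<lambda>t. B t \<omega>) t a - Phi (\<lambda>t. B t \<omega>) s a) ^ (2 * p))) \<and>
        (\<integral>\<^sup>+\<omega>. Z \<omega> \<partial>M) \<le> ennreal (fact (2 * p) * ((t - s) * (2 * L + (t - s) * ?E)) ^ p)"
    proof (rule bexI[of _ Z], intro conjI allI impI)
      show "Z \<in> borel_measurable M" unfolding Z_def by (intro borel_measurable_liminf Sm)
      show "Z \<omega> = ennreal (norm (Phi (\<lambda>t. B t \<omega>) t a - Phi (\<lambda>t. B t \<omega>) s a) ^ (2 * p))"
        if c: "continuous_on {0..} (\<lambda>t. B t \<omega>)" for \<omega>
      proof -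
        have "continuous_on {s..t} (\<lambda>r. iexp (a \<bullet> B r \<omega>))"
          using st by (intro continuous_intros continuous_on_subset[OF c]) auto
        hence "(\<lambda>n. S n \<omega>) \<longlonglongrightarrow> Phi (\<lambda>t. B t \<omega>) t a - Phi (\<lambda>t. B t \<omega>) s a"
          using riemann_sum_tendsto_integral[of s t "\<lambda>r. iexp (a \<bullet> B r \<omega>)"] st
          by (simp add: S_def \<Delta>_def x_def Phi_diff[OF c] del: sum.lessThan_Suc of_nat_Suc of_real_divide)
        thus ?thesis unfolding Z_def
          by (intro lim_imp_Liminf tendsto_ennrealI tendsto_power tendsto_norm) auto
      qed
      have "(\<integral>\<^sup>+\<omega>. Z \<omega> \<partial>M) \<le> liminf (\<lambda>n. \<integral>\<^sup>+\<omega>. ennreal (norm (S n \<omega>) ^ (2 * p)) \<partial>M)"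
        unfolding Z_def by (rule nn_integral_liminf) (rule Sm)
      also have "\<dots> \<le> liminf (\<lambda>n. ennreal (fact (2 * p) * ((t - s) * (2 * L + \<Delta> n + (t - s) * ?E)) ^ p))"
      proof (intro Liminf_mono always_eventually allI)
        fix n
        have "(\<integral>\<^sup>+\<omega>. ennreal (norm (S n \<omega>) ^ (2 * p)) \<partial>M) = ennreal (\<integral>\<omega>. norm (S n \<omega>) ^ (2 * p) \<partial>M)"
          using S[of n] by (intro nn_integral_eq_integral) auto
        also have "\<dots> \<le> ennreal (fact (2 * p) * ((t - s) * (2 * L + \<Delta> n + (t - s) * ?E)) ^ p)"
          using S[of n] by (intro ennreal_leI) auto
        finally show "(\<integral>\<^sup>+\<omega>. ennreal (norm (S n \<omega>) ^ (2 * p)) \<partial>M)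
          \<le> ennreal (fact (2 * p) * ((t - s) * (2 * L + \<Delta> n + (t - s) * ?E)) ^ p)" .
      qed
      \<comment> \<open>The mesh term in the bound for the Riemann sums disappears in the
        limit.\<close>
      also have "\<dots> = ennreal (fact (2 * p) * ((t - s) * (2 * L + 0 + (t - s) * ?E)) ^ p)"
        by (intro lim_imp_Liminf tendsto_ennrealI tendsto_intros \<Delta>0) auto
      finally show "(\<integral>\<^sup>+\<omega>. Z \<omega> \<partial>M) \<le> ennreal (fact (2 * p) * ((t - s) * (2 * L + (t - s) * ?E)) ^ p)"
        by simp
    qed
  qed
qed

section \<open>Power decay of the moments in the frequency\<close>

lemma exp_powr_decay:
  fixes \<beta> \<delta> q :: real
  assumes "0 < \<beta>" "0 < \<delta>"
  obtains C where "0 < C" "\<And>x. 1 \<le> x \<Longrightarrow> exp (- (\<beta> * x powr \<delta>)) \<le> C * x powr (- q)"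
proof -
  \<comment> \<open>With n this large, the single term y^n / n! of the exponential series already
    gives the desired decay.\<close>
  obtain n :: nat where n: "q / \<delta> \<le> real n" using real_arch_simple by blast
  hence n': "q \<le> \<delta> * real n" using assms by (simp add: field_simps)
  show thesis
  proof (rule that)
    show "0 < fact n / \<beta> ^ n" using assms by simp
    fix x :: real assume x: "1 \<le> x"
    define y where "y = \<beta> * x powr \<delta>"
    have y: "0 < y" using assms x by (simp add: y_def)
    have "y ^ n / fact n = (\<Sum>k\<in>{n}. y ^ k /\<^sub>R fact k)" by (simp add: divide_inverse mult.commute)
    also have "\<dots> \<le> (\<Sum>k. y ^ k /\<^sub>R fact k)"
      using y by (intro sum_le_suminf summable_exp_generic) auto
    also have "\<dots> = exp y" by (simp add: exp_def)
    finally have "exp (- y) \<le> fact n / y ^ n"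
      using y by (simp add: exp_minus field_simps)
    also have "\<dots> = fact n / \<beta> ^ n * x powr (- (\<delta> * real n))"
      using x by (simp add: y_def power_mult_distrib powr_minus powr_powr[symmetric] powr_realpow divide_inverse)
    also have "\<dots> \<le> fact n / \<beta> ^ n * x powr (- q)"
      using x n' assms by (intro mult_left_mono powr_mono) auto
    finally show "exp (- (\<beta> * x powr \<delta>)) \<le> fact n / \<beta> ^ n * x powr (- q)" by (simp add: y_def)
  qed
qed

text \<open>The cut-off \<open>L = norm a powr (- q)\<close> makes the exponent a multiple of
  \<open>norm a powr (2 - 2 * H * q)\<close>. This power is positive exactly because q < 1/H, so the
  exponential is bounded by a constant times L and both terms have the same order.\<close>

lemma fbm_Phi_moment_powr:
  fixes B :: "real \<Rightarrow> 'a \<Rightarrow> real ^ 'n"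
  assumes M: "prob_space M" and H: "0 < H" "H < 1" and fbm: "fractional_brownian_motion M H B"
    and T: "0 < T" and q: "q < 1 / H"
  obtains C where "0 < C"
    "\<And>a s t. 0 \<le> s \<Longrightarrow> s < t \<Longrightarrow> t \<le> T \<Longrightarrow> 1 \<le> norm a \<Longrightarrow>
      \<exists>Z \<in> borel_measurable M.
        (\<forall>\<omega>. continuous_on {0..} (\<lambda>t. B t \<omega>) \<longrightarrow>
          Z \<omega> = ennreal (norm (Phi (\<lambda>t. B t \<omega>) t a - Phi (\<lambda>t. B t \<omega>) s a) ^ (2 * p))) \<and>
        (\<integral>\<^sup>+\<omega>. Z \<omega> \<partial>M) \<le> ennreal (C * ((t - s) * norm a powr (- q)) ^ p)"
proof -
  obtain \<beta> where \<beta>: "0 < \<beta>" and mom: "\<And>a s t L. 0 \<le> s \<Longrightarrow> s < t \<Longrightarrow> 0 < L \<Longrightarrow>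
      \<exists>Z \<in> borel_measurable M.
        (\<forall>\<omega>. continuous_on {0..} (\<lambda>t. B t \<omega>) \<longrightarrow>
          Z \<omega> = ennreal (norm (Phi (\<lambda>t. B t \<omega>) t a - Phi (\<lambda>t. B t \<omega>) s a) ^ (2 * p))) \<and>
        (\<integral>\<^sup>+\<omega>. Z \<omega> \<partial>M) \<le> ennreal (fact (2 * p) *
          ((t - s) * (2 * L + (t - s) * exp (- (\<beta> * (norm a)\<^sup>2 * L powr (2 * H))))) ^ p)"
    using fbm_Phi_moment[OF M H fbm, of p] by blast
  have "0 < 2 - 2 * H * q" using H q by (simp add: field_simps)
  then obtain C where C: "0 < C" "\<And>x. 1 \<le> x \<Longrightarrow> exp (- (\<beta> * x powr (2 - 2 * H * q))) \<le> C * x powr (- q)"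
    using exp_powr_decay[OF \<beta>, of "2 - 2 * H * q" q] by blast
  show thesis
  proof (rule that)
    show "0 < fact (2 * p) * (2 + T * C) ^ p" using C T by (simp add: add_pos_pos)
    fix a :: "real ^ 'n" and s t :: real
    assume st: "0 \<le> s" "s < t" "t \<le> T" and a: "1 \<le> norm a"
    define L where "L = norm a powr (- q)"
    have a0: "a \<noteq> 0" using a by auto
    hence L: "0 < L" by (simp add: L_def)
    have "(norm a)\<^sup>2 * L powr (2 * H) = norm a powr 2 * norm a powr (- (2 * H * q))"
      using a0 by (simp add: L_def powr_powr mult_ac)
    also have "\<dots> = norm a powr (2 - 2 * H * q)" by (simp only: powr_add[symmetric] add_uminus_conv_diff)
    finally have eq: "\<beta> * (norm a)\<^sup>2 * L powr (2 * H) = \<beta> * norm a powr (2 - 2 * H * q)" by simp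
    have "(t - s) * exp (- (\<beta> * (norm a)\<^sup>2 * L powr (2 * H))) \<le> T * (C * L)"
      unfolding eq using C(2)[OF a] st by (intro mult_mono) (auto simp: L_def)
    hence "(t - s) * (2 * L + (t - s) * exp (- (\<beta> * (norm a)\<^sup>2 * L powr (2 * H)))) \<le> (t - s) * (2 * L + T * (C * L))"
      using st by (intro mult_left_mono add_left_mono) auto
    also have "\<dots> = (2 + T * C) * ((t - s) * L)" by (simp add: algebra_simps)
    finally have "fact (2 * p) * ((t - s) * (2 * L + (t - s) * exp (- (\<beta> * (norm a)\<^sup>2 * L powr (2 * H))))) ^ p
        \<le> fact (2 * p) * ((2 + T * C) * ((t - s) * L)) ^ p"
      using st L by (intro mult_left_mono power_mono) auto
    also have "\<dots> = fact (2 * p) * (2 + T * C) ^ p * ((t - s) * norm a powr (- q)) ^ p"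
      by (simp add: power_mult_distrib L_def)
    finally have le: "ennreal (fact (2 * p) * ((t - s) * (2 * L + (t - s) * exp (- (\<beta> * (norm a)\<^sup>2 * L powr (2 * H))))) ^ p)
        \<le> ennreal (fact (2 * p) * (2 + T * C) ^ p * ((t - s) * norm a powr (- q)) ^ p)"
      by (rule ennreal_leI)
    show "\<exists>Z \<in> borel_measurable M.
        (\<forall>\<omega>. continuous_on {0..} (\<lambda>t. B t \<omega>) \<longrightarrow>
          Z \<omega> = ennreal (norm (Phi (\<lambda>t. B t \<omega>) t a - Phi (\<lambda>t. B t \<omega>) s a) ^ (2 * p))) \<and>
        (\<integral>\<^sup>+\<omega>. Z \<omega> \<partial>M) \<le> ennreal (fact (2 * p) * (2 + T * C) ^ p * ((t - s) * norm a powr (- q)) ^ p)"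
      using mom[OF st(1,2) L, of a] le order_trans by blast
  qed
qed

text \<open>The sum of all the variables has finite expectation, hence is almost surely finite, and
  it dominates each of them. The requirement that K be at least 1 makes it easy to take roots of the
  bound later.\<close>

lemma AE_bounded_of_summable_nn_integral:
  fixes U :: "nat \<Rightarrow> 'i \<Rightarrow> 'a \<Rightarrow> ennreal"
  assumes U: "\<And>k x. x \<in> F k \<Longrightarrow> U k x \<in> borel_measurable M"
    and F: "\<And>k. finite (F k)"
    and c: "summable c" "\<And>k. 0 \<le> c k"
    and le: "\<And>k. (\<Sum>x\<in>F k. \<integral>\<^sup>+\<omega>. U k x \<omega> \<partial>M) \<le> ennreal (c k)"
  shows "AE \<omega> in M. \<exists>K\<ge>1. \<forall>k. \<forall>x\<in>F k. U k x \<omega> \<le> ennreal K"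
proof -
  let ?Y = "\<lambda>\<omega>. \<Sum>k. \<Sum>x\<in>F k. U k x \<omega>"
  have m: "(\<lambda>\<omega>. \<Sum>x\<in>F k. U k x \<omega>) \<in> borel_measurable M" for k
    using U by (intro borel_measurable_sum) auto
  have "(\<integral>\<^sup>+\<omega>. ?Y \<omega> \<partial>M) = (\<Sum>k. \<Sum>x\<in>F k. \<integral>\<^sup>+\<omega>. U k x \<omega> \<partial>M)"
    using U by (simp add: nn_integral_suminf[OF m] nn_integral_sum)
  also have "\<dots> \<le> (\<Sum>k. ennreal (c k))" by (intro suminf_le le) auto
  also have "\<dots> < \<infinity>" using ennreal_suminf_neq_top[OF c] by (simp add: less_top)
  finally have "(\<integral>\<^sup>+\<omega>. ?Y \<omega> \<partial>M) \<noteq> \<infinity>" by simp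
  moreover have "?Y \<in> borel_measurable M" using m by (intro borel_measurable_suminf_order)
  ultimately have "AE \<omega> in M. ?Y \<omega> \<noteq> \<infinity>" by (intro nn_integral_PInf_AE)
  thus ?thesis
  proof eventually_elim
    fix \<omega> assume "?Y \<omega> \<noteq> \<infinity>"
    then obtain K where K: "?Y \<omega> = ennreal K" "0 \<le> K" by (cases "?Y \<omega>") auto
    have "U k x \<omega> \<le> ennreal (K + 1)" if "x \<in> F k" for k x
    proof -
      have "U k x \<omega> \<le> (\<Sum>x\<in>F k. U k x \<omega>)" using F that by (intro member_le_sum) auto
      also have "\<dots> = (\<Sum>k\<in>{k}. \<Sum>x\<in>F k. U k x \<omega>)" by simp
      also have "\<dots> \<le> ?Y \<omega>" by (intro sum_le_suminf) auto
      also have "\<dots> \<le> ennreal (K + 1)" using K by (simp add: ennreal_leI)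
      finally show ?thesis .
    qed
    thus "\<exists>K\<ge>1. \<forall>k. \<forall>x\<in>F k. U k x \<omega> \<le> ennreal K" using K(2) by (intro exI[of _ "K + 1"]) auto
  qed
qed

section \<open>Deterministic estimates along one continuous path\<close>

lemma norm_Phi_diff_le:
  assumes w: "continuous_on {0..} w" and st: "0 \<le> s" "s \<le> t"
  shows "norm (Phi w t a - Phi w s a) \<le> t - s"
proof -
  have i: "(\<lambda>r. iexp (a \<bullet> w r)) integrable_on {s..t}"
    using st by (intro integrable_continuous_real continuous_intros continuous_on_subset[OF w]) auto
  have "norm (integral {s..t} (\<lambda>r. iexp (a \<bullet> w r))) \<le> integral {s..t} (\<lambda>r. 1 :: real)"
    by (rule integral_norm_bound_integral[OF i]) auto
  thus ?thesis using st by (simp add: Phi_diff[OF assms])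
qed

lemma norm_iexp_diff_le: "norm (iexp x - iexp y) \<le> \<bar>x - y\<bar>"
proof -
  have "iexp x - iexp y = iexp y * (iexp (x - y) - 1)"
    by (simp add: right_diff_distrib mult_exp_exp algebra_simps)
  hence "norm (iexp x - iexp y) = norm (iexp (x - y) - 1)" by (simp add: norm_mult)
  also have "\<dots> \<le> \<bar>x - y\<bar>" using iexp_approx1[of "x - y" 0] by simp
  finally show ?thesis .
qed

lemma norm_Phi_diff_lipschitz:
  assumes w: "continuous_on {0..} w" and st: "0 \<le> s" "s \<le> t"
    and R: "\<And>r. r \<in> {s..t} \<Longrightarrow> norm (w r) \<le> R"
  shows "norm ((Phi w t a - Phi w s a) - (Phi w t b - Phi w s b)) \<le> (t - s) * (norm (a - b) * R)"
proof -
  have i: "(\<lambda>r. iexp (a \<bullet> w r)) integrable_on {s..t}" for a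
    using st by (intro integrable_continuous_real continuous_intros continuous_on_subset[OF w]) auto
  have "(Phi w t a - Phi w s a) - (Phi w t b - Phi w s b) = integral {s..t} (\<lambda>r. iexp (a \<bullet> w r) - iexp (b \<bullet> w r))"
    by (simp only: Phi_diff[OF w st] Henstock_Kurzweil_Integration.integral_diff[OF i i])
  also have "norm \<dots> \<le> integral {s..t} (\<lambda>r. norm (a - b) * R)"
  proof (rule integral_norm_bound_integral)
    fix r assume r: "r \<in> {s..t}"
    have "norm (iexp (a \<bullet> w r) - iexp (b \<bullet> w r)) \<le> \<bar>(a - b) \<bullet> w r\<bar>"
      using norm_iexp_diff_le by (simp only: inner_diff_left)
    also have "\<dots> \<le> norm (a - b) * norm (w r)" by (rule Cauchy_Schwarz_ineq2)
    also have "\<dots> \<le> norm (a - b) * R" using R[OF r] by (intro mult_left_mono) auto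
    finally show "norm (iexp (a \<bullet> w r) - iexp (b \<bullet> w r)) \<le> norm (a - b) * R" .
  qed (auto intro!: Henstock_Kurzweil_Integration.integrable_diff i)
  finally show ?thesis using st by (simp add: mult_ac)
qed

section \<open>Reduction to a grid\<close>

definition lattice_pt :: "nat \<Rightarrow> nat \<Rightarrow> ('n \<Rightarrow> int) \<Rightarrow> real ^ 'n" where
  "lattice_pt k m z = (\<chi> c. real_of_int (z c) / real k ^ m)"

text \<open>Rounding each coordinate down moves the point by at most \<open>CARD('n)\<close>, which
  is at most k/2; hence the lattice point keeps norm at least k/2. Rounding also accounts for the
  step from k + 1 to k + 2 in the box.\<close>

lemma ex_lattice_pt_near:
  fixes a :: "real ^ 'n"
  assumes k: "2 * CARD('n) \<le> k" "real k \<le> norm a" "norm a < real k + 1"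
  obtains z where "\<And>c. \<bar>z c\<bar> \<le> int ((k + 2) * k ^ m)"
    "real k / 2 \<le> norm (lattice_pt k m z :: real ^ 'n)"
    "norm (a - lattice_pt k m z) \<le> real CARD('n) / real k ^ m"
proof -
  define N where "N = real k ^ m"
  have "1 \<le> CARD('n)" using zero_less_card_finite[where 'a='n] by linarith
  hence k1: "1 \<le> k" "2 * real CARD('n) \<le> real k" using k(1) by linarith+
  hence N: "1 \<le> N" by (simp add: N_def one_le_power)
  define z where "z c = \<lfloor>a $ c * N\<rfloor>" for c
  let ?g = "lattice_pt k m z :: real ^ 'n"
  have g: "?g $ c = real_of_int (z c) / N" for c by (simp add: lattice_pt_def N_def)
  have comp: "\<bar>(a - ?g) $ c\<bar> \<le> 1 / N" for c
  proof -
    have "\<bar>a $ c * N - real_of_int (z c)\<bar> \<le> 1" unfolding z_def by linarith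
    hence "\<bar>a $ c * N - real_of_int (z c)\<bar> / N \<le> 1 / N" using N by (intro divide_right_mono) auto
    moreover have "(a - ?g) $ c = (a $ c * N - real_of_int (z c)) / N"
      using N by (simp add: g field_simps)
    ultimately show ?thesis using N by simp
  qed
  have near: "norm (a - ?g) \<le> real CARD('n) / N"
  proof -
    have "norm (a - ?g) \<le> (\<Sum>c\<in>UNIV. \<bar>(a - ?g) $ c\<bar>)" by (rule norm_le_l1_cart)
    also have "\<dots> \<le> (\<Sum>c\<in>(UNIV :: 'n set). 1 / N)" by (intro sum_mono comp)
    finally show ?thesis by simp
  qed
  show thesis
  proof (rule that)
    show "norm (a - ?g) \<le> real CARD('n) / real k ^ m" using near by (simp add: N_def)
    have "norm (a - ?g) \<le> real CARD('n)" 
      using near N divide_left_mono[of 1 N "real CARD('n)"] by simp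
    moreover have "norm a \<le> norm ?g + norm (a - ?g)" using norm_triangle_sub by blast
    ultimately show "real k / 2 \<le> norm ?g" using k k1 by linarith
    show "\<bar>z c\<bar> \<le> int ((k + 2) * k ^ m)" for c
    proof -
      have "\<bar>a $ c\<bar> \<le> real k + 1" using component_le_norm_cart[of a c] k by linarith
      hence "\<bar>a $ c * N\<bar> \<le> (real k + 1) * N" using N by (simp add: abs_mult mult_right_mono)
      moreover have "\<bar>real_of_int (z c)\<bar> \<le> \<bar>a $ c * N\<bar> + 1" unfolding z_def by linarith
      ultimately have "\<bar>real_of_int (z c)\<bar> \<le> (real k + 2) * N" using N by (simp add: algebra_simps)
      hence "real_of_int \<bar>z c\<bar> \<le> real_of_int (int ((k + 2) * k ^ m))" by (simp add: N_def algebra_simps)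
      thus ?thesis by (simp only: of_int_le_iff)
    qed
  qed
qed

text \<open>Increments over at most four mesh widths are bounded trivially. Otherwise the frequency
  is moved to the lattice and both times are rounded into the interval, at the cost of one Lipschitz
  error and two short increments. The constant 6 covers the numerical losses of both cases.\<close>

lemma Phi_bound_of_grid:
  fixes w :: "real \<Rightarrow> real ^ 'n"
  assumes w: "continuous_on {0..} w" and R: "\<And>r. r \<in> {0..T} \<Longrightarrow> norm (w r) \<le> R" "0 \<le> R"
    and \<gamma>: "0 < \<gamma>" "\<gamma> \<le> 3/4" and m: "0 < \<rho>" "4 * \<rho> \<le> real m"
    and k: "2 * CARD('n) \<le> k" "real k \<le> norm a" "norm a < real k + 1"
    and K: "0 \<le> K" and st: "0 \<le> s" "s < t" "t \<le> T"
    and grid: "\<And>i j z. i < j \<Longrightarrow> real j \<le> T * real k ^ m \<Longrightarrow> (\<And>c. \<bar>z c\<bar> \<le> int ((k + 2) * k ^ m)) \<Longrightarrow>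
        real k / 2 \<le> norm (lattice_pt k m z :: real ^ 'n) \<Longrightarrow>
        norm (Phi w (real j / real k ^ m) (lattice_pt k m z) - Phi w (real i / real k ^ m) (lattice_pt k m z))
          \<le> K * ((real j - real i) / real k ^ m) powr \<gamma> * real k powr (- \<rho>)"
  shows "norm (Phi w t a - Phi w s a) \<le> (6 + K + T powr (1 - \<gamma>) * real CARD('n) * R) * (t - s) powr \<gamma> * real k powr (- \<rho>)"
    (is "_ \<le> ?C * _ * _")
proof -
  define N where "N = real k ^ m"
  define h where "h = 1 / N"
  define D where "D = (t - s) powr \<gamma> * real k powr (- \<rho>)"
  have "1 \<le> CARD('n)" using zero_less_card_finite[where 'a='n] by linarith
  hence k1: "1 \<le> real k" using k(1) by linarith
  hence N: "1 \<le> N" by (simp add: N_def one_le_power)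
  have h: "0 < h" "h \<le> 1" using N by (auto simp: h_def)
  have T: "0 \<le> T" using st by linarith
  have hN: "h = real k powr (- real m)"
    using k1 by (simp add: h_def N_def powr_minus powr_realpow divide_inverse)
  have h\<gamma>: "h powr (1 - \<gamma>) \<le> real k powr (- \<rho>)"
  proof -
    have "real m / 4 \<le> real m * (1 - \<gamma>)" using \<gamma> mult_left_mono[of "1/4" "1 - \<gamma>" "real m"] by simp
    hence "\<rho> \<le> real m * (1 - \<gamma>)" using m by linarith
    thus ?thesis unfolding hN powr_powr using k1 by (intro powr_mono) auto
  qed
  have h\<rho>: "h \<le> real k powr (- \<rho>)"
    unfolding hN using k1 m by (intro powr_mono) auto
  have ts: "t - s = (t - s) powr \<gamma> * (t - s) powr (1 - \<gamma>)" using st by (simp flip: powr_add)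
  have D0: "0 \<le> D" by (simp add: D_def)
  have C: "4 \<le> ?C" using K R T by simp
  show ?thesis
  proof (cases "t - s \<le> 4 * h")
    case True
    have "(t - s) powr (1 - \<gamma>) \<le> (4 * h) powr (1 - \<gamma>)" using True st \<gamma> by (intro powr_mono2) auto
    also have "\<dots> = 4 powr (1 - \<gamma>) * h powr (1 - \<gamma>)" using h by (simp add: powr_mult)
    also have "\<dots> \<le> 4 powr 1 * real k powr (- \<rho>)" using h\<gamma> \<gamma> by (intro mult_mono powr_mono) auto
    finally have "t - s \<le> (t - s) powr \<gamma> * (4 * real k powr (- \<rho>))"
      using ts mult_left_mono[of "(t - s) powr (1 - \<gamma>)" "4 * real k powr (- \<rho>)" "(t - s) powr \<gamma>"] by simp
    hence "t - s \<le> 4 * D" by (simp add: D_def)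
    also have "\<dots> \<le> ?C * D" using C D0 by (intro mult_right_mono)
    finally show ?thesis using norm_Phi_diff_le[OF w st(1), of t a] st by (simp add: D_def mult.assoc)
  next
    case False
    define i where "i = nat \<lceil>s * N\<rceil>"
    define j where "j = nat \<lfloor>t * N\<rfloor>"
    have "real i = real_of_int \<lceil>s * N\<rceil>" "real j = real_of_int \<lfloor>t * N\<rfloor>"
      using st N by (simp_all add: i_def j_def)
    hence i: "s * N \<le> real i" "real i < s * N + 1" and j: "real j \<le> t * N" "t * N - 1 < real j"
      by linarith+
    have "4 < (t - s) * N" using False N by (simp add: h_def field_simps)
    \<comment> \<open>Rounding s up and t down removes less than one mesh width each from a gap of
      more than four.\<close>
    hence ij: "i < j" using i j by (simp add: algebra_simps)
    define s' where "s' = real i / N"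
    define t' where "t' = real j / N"
    have s': "s \<le> s'" "s' \<le> s + h" using i N by (auto simp: s'_def h_def field_simps)
    have t': "t' \<le> t" "t - h \<le> t'"
    proof -
      show "t' \<le> t" using j N by (simp add: t'_def pos_divide_le_eq)
      have "(t * N - 1) / N \<le> t'" unfolding t'_def using j N by (intro divide_right_mono) auto
      thus "t - h \<le> t'" using N by (simp add: h_def diff_divide_distrib)
    qed
    have st': "s' \<le> t'" using ij N by (simp add: s'_def t'_def divide_right_mono)
    have "t * N \<le> T * N" using st N by simp
    hence jT: "real j \<le> T * real k ^ m" using j by (simp add: N_def)
    obtain z where z: "\<And>c. \<bar>z c\<bar> \<le> int ((k + 2) * k ^ m)"
      "real k / 2 \<le> norm (lattice_pt k m z :: real ^ 'n)"
      "norm (a - lattice_pt k m z) \<le> real CARD('n) * h"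
      using ex_lattice_pt_near[OF k, of m] by (auto simp: h_def N_def)
    let ?g = "lattice_pt k m z :: real ^ 'n"
    have 1: "norm ((Phi w t a - Phi w s a) - (Phi w t ?g - Phi w s ?g)) \<le> T powr (1 - \<gamma>) * real CARD('n) * R * D"
    proof -
      have "norm ((Phi w t a - Phi w s a) - (Phi w t ?g - Phi w s ?g)) \<le> (t - s) * (norm (a - ?g) * R)"
        using st R by (intro norm_Phi_diff_lipschitz[OF w]) auto
      also have "\<dots> \<le> (t - s) * ((real CARD('n) * real k powr (- \<rho>)) * R)"
        using st R z(3) h\<rho> by (intro mult_left_mono mult_right_mono order_trans[OF z(3)]) auto
      also have "\<dots> \<le> ((t - s) powr \<gamma> * T powr (1 - \<gamma>)) * ((real CARD('n) * real k powr (- \<rho>)) * R)"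
        using st R \<gamma> by (subst ts, intro mult_right_mono mult_left_mono powr_mono2) auto
      finally show ?thesis by (simp add: D_def mult_ac)
    qed
    have 2: "norm (Phi w t' ?g - Phi w s' ?g) \<le> K * D"
    proof -
      have "norm (Phi w t' ?g - Phi w s' ?g) \<le> K * ((real j - real i) / real k ^ m) powr \<gamma> * real k powr (- \<rho>)"
        using grid[OF ij jT z(1,2)] by (simp add: t'_def s'_def N_def)
      also have "(real j - real i) / real k ^ m = t' - s'" by (simp add: t'_def s'_def N_def diff_divide_distrib)
      also have "K * (t' - s') powr \<gamma> * real k powr (- \<rho>) \<le> K * (t - s) powr \<gamma> * real k powr (- \<rho>)"
        using K st' s' t' \<gamma> by (intro mult_right_mono mult_left_mono powr_mono2) auto
      finally show ?thesis by (simp add: D_def mult_ac)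
    qed
    \<comment> \<open>A mesh width is shorter than t - s here, so \<open>h powr \<gamma>\<close> is
      at most \<open>(t - s) powr \<gamma>\<close> and the rounding errors in time fit into
      \<open>D\<close>.\<close>
    have hD: "h \<le> D"
    proof -
      have "h = h powr \<gamma> * h powr (1 - \<gamma>)" using h by (simp flip: powr_add)
      also have "\<dots> \<le> (t - s) powr \<gamma> * real k powr (- \<rho>)"
        using h\<gamma> False h \<gamma> by (intro mult_mono powr_mono2) auto
      finally show ?thesis by (simp add: D_def)
    qed
    have 3: "norm (Phi w s' ?g - Phi w s ?g) \<le> D" "norm (Phi w t ?g - Phi w t' ?g) \<le> D"
      using norm_Phi_diff_le[OF w, of s s' ?g] norm_Phi_diff_le[OF w, of t' t ?g] s' t' st st' hD by linarith+
    have "Phi w t a - Phi w s a = ((Phi w t a - Phi w s a) - (Phi w t ?g - Phi w s ?g))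
        + (Phi w t' ?g - Phi w s' ?g) + (Phi w s' ?g - Phi w s ?g) + (Phi w t ?g - Phi w t' ?g)" by simp
    hence "norm (Phi w t a - Phi w s a) \<le> T powr (1 - \<gamma>) * real CARD('n) * R * D + K * D + D + D"
      using 1 2 3 by (metis (no_types, lifting) add_mono norm_triangle_mono)
    also have "\<dots> \<le> ?C * D" using D0 by (simp add: algebra_simps)
    finally show ?thesis by (simp add: D_def mult.assoc)
  qed
qed

text \<open>For bounded frequencies the trivial estimate by t - s suffices, because \<gamma> < 1.
  For the others k is the integer part of the norm, and replacing 1 + |a| by 3k costs only a
  constant.\<close>

lemma irregular_of_grid:
  fixes w :: "real \<Rightarrow> real ^ 'n"
  assumes w: "continuous_on {0..} w" and T: "0 < T"
    and \<gamma>: "0 < \<gamma>" "\<gamma> \<le> 3/4" and m: "0 < \<rho>" "4 * \<rho> \<le> real m"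
    and K: "0 \<le> K"
    and grid: "\<And>k i j z. 2 * CARD('n) \<le> k \<Longrightarrow> i < j \<Longrightarrow> real j \<le> T * real k ^ m \<Longrightarrow>
        (\<And>c. \<bar>z c\<bar> \<le> int ((k + 2) * k ^ m)) \<Longrightarrow>
        real k / 2 \<le> norm (lattice_pt k m z :: real ^ 'n) \<Longrightarrow>
        norm (Phi w (real j / real k ^ m) (lattice_pt k m z) - Phi w (real i / real k ^ m) (lattice_pt k m z))
          \<le> K * ((real j - real i) / real k ^ m) powr \<gamma> * real k powr (- \<rho>)"
  shows "irregular \<rho> \<gamma> T w"
proof -
  have wT: "continuous_on {0..T} w" using w by (rule continuous_on_subset) auto
  hence "bounded (w ` {0..T})" by (intro compact_imp_bounded compact_continuous_image) auto
  then obtain R where R: "\<And>r. r \<in> {0..T} \<Longrightarrow> norm (w r) \<le> R" "0 < R"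
    unfolding bounded_pos by blast
  define k0 where "k0 = 2 * CARD('n)"
  define C1 where "C1 = 6 + K + T powr (1 - \<gamma>) * real CARD('n) * R"
  define C where "C = (2 + real k0) powr \<rho> * T powr (1 - \<gamma>) + 3 powr \<rho> * C1"
  have C1: "0 \<le> C1" using K R by (simp add: C1_def)
  have bound: "(1 + norm a) powr \<rho> * (norm (Phi w t a - Phi w s a) / \<bar>t - s\<bar> powr \<gamma>) \<le> C"
    if st: "0 \<le> s" "s < t" "t \<le> T" for a s t
  proof (cases "norm a < real k0 + 1")
    case True
    have "norm (Phi w t a - Phi w s a) \<le> t - s"
      using norm_Phi_diff_le[OF w st(1)] st by auto
    hence "norm (Phi w t a - Phi w s a) / \<bar>t - s\<bar> powr \<gamma> \<le> (t - s) / (t - s) powr \<gamma>"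
      using st by (simp add: divide_right_mono)
    also have "\<dots> = (t - s) powr (1 - \<gamma>)" using st by (simp add: powr_diff)
    also have "\<dots> \<le> T powr (1 - \<gamma>)" using st \<gamma> by (intro powr_mono2) auto
    finally have "(1 + norm a) powr \<rho> * (norm (Phi w t a - Phi w s a) / \<bar>t - s\<bar> powr \<gamma>)
        \<le> (2 + real k0) powr \<rho> * T powr (1 - \<gamma>)"
      using True m by (intro mult_mono powr_mono2) auto
    thus ?thesis using C1 by (simp add: C_def add_increasing2)
  next
    case False
    define k where "k = nat \<lfloor>norm a\<rfloor>"
    have k: "real k \<le> norm a" "norm a < real k + 1" by (auto simp: k_def of_nat_nat)
    hence kk: "2 * CARD('n) \<le> k" using False by (simp add: k0_def)
    have "1 \<le> CARD('n)" using zero_less_card_finite[where 'a='n] by linarith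
    hence k1: "1 \<le> real k" using kk by linarith
    have "norm (Phi w t a - Phi w s a) \<le> C1 * (t - s) powr \<gamma> * real k powr (- \<rho>)"
      unfolding C1_def using R grid[OF kk] kk k K m \<gamma> st
      by (intro Phi_bound_of_grid[OF w _ _ \<gamma> m]) auto
    hence "norm (Phi w t a - Phi w s a) / \<bar>t - s\<bar> powr \<gamma> \<le> C1 * real k powr (- \<rho>)"
      using st by (simp add: divide_le_eq mult_ac)
    hence "(1 + norm a) powr \<rho> * (norm (Phi w t a - Phi w s a) / \<bar>t - s\<bar> powr \<gamma>)
        \<le> (3 * real k) powr \<rho> * (C1 * real k powr (- \<rho>))"
      using k k1 m by (intro mult_mono powr_mono2) auto
    also have "\<dots> = 3 powr \<rho> * C1" using k1 by (simp add: powr_mult powr_minus)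
    also have "\<dots> \<le> C" by (simp add: C_def)
    finally show ?thesis .
  qed
  have "W_norm \<rho> \<gamma> T (Phi w) \<le> ennreal C"
    unfolding W_norm_def
  proof (intro SUP_least)
    fix a x assume "x \<in> {(s, t). 0 \<le> s \<and> s < t \<and> t \<le> T}"
    thus "(case x of (s, t) \<Rightarrow> ennreal ((1 + norm a) powr \<rho> * (norm (Phi w t a - Phi w s a) / \<bar>t - s\<bar> powr \<gamma>))) \<le> ennreal C"
      using bound by (cases x) (simp add: ennreal_leI del: times_divide_eq_right)
  qed
  hence "W_norm \<rho> \<gamma> T (Phi w) < \<infinity>" by (rule le_less_trans) simp
  thus ?thesis using wT m \<gamma> by (simp add: irregular_def)
qed

section \<open>Counting grid points\<close>

lemma card_lattice_box_le:
  "finite {z :: 'n :: finite \<Rightarrow> int. \<forall>c. \<bar>z c\<bar> \<le> int b}"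
  "card {z :: 'n :: finite \<Rightarrow> int. \<forall>c. \<bar>z c\<bar> \<le> int b} = (2 * b + 1) ^ CARD('n)"
proof -
  have eq: "{z :: 'n \<Rightarrow> int. \<forall>c. \<bar>z c\<bar> \<le> int b} = (UNIV :: 'n set) \<rightarrow>\<^sub>E {- int b..int b}"
  proof -
    have "\<bar>x\<bar> \<le> int b \<longleftrightarrow> x \<in> {- int b..int b}" for x by auto
    thus ?thesis by (auto simp only: PiE_UNIV_domain Pi_iff)
  qed
  show "finite {z :: 'n \<Rightarrow> int. \<forall>c. \<bar>z c\<bar> \<le> int b}" unfolding eq by (intro finite_PiE) auto
  show "card {z :: 'n \<Rightarrow> int. \<forall>c. \<bar>z c\<bar> \<le> int b} = (2 * b + 1) ^ CARD('n)"
    unfolding eq by (simp add: card_PiE nat_add_distrib nat_mult_distrib)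
qed

text \<open>The triples quantified over in \<open>irregular_of_grid\<close>, collected in one set so
  that moments can be summed over it. The lower bound on the lattice point keeps the moment estimate
  strong.\<close>

definition grid_points :: "real \<Rightarrow> nat \<Rightarrow> nat \<Rightarrow> (nat \<times> nat \<times> ('n :: finite \<Rightarrow> int)) set" where
  "grid_points T m k = {(i, j, z). i < j \<and> real j \<le> T * real k ^ m \<and> (\<forall>c. \<bar>z c\<bar> \<le> int ((k + 2) * k ^ m))
      \<and> real k / 2 \<le> norm (lattice_pt k m z :: real ^ 'n)}"

lemma grid_points_card:
  assumes "0 < T"
  shows "finite (grid_points T m k :: (nat \<times> nat \<times> ('n :: finite \<Rightarrow> int)) set)"
    and "1 \<le> k \<Longrightarrow> real (card (grid_points T m k :: (nat \<times> nat \<times> ('n :: finite \<Rightarrow> int)) set))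
      \<le> (T + 1)\<^sup>2 * 7 ^ CARD('n) * real k ^ (2 * m + (m + 1) * CARD('n))"
proof -
  let ?J = "{..nat \<lfloor>T * real k ^ m\<rfloor>}"
  let ?B = "{z :: 'n \<Rightarrow> int. \<forall>c. \<bar>z c\<bar> \<le> int ((k + 2) * k ^ m)}"
  have sub: "grid_points T m k \<subseteq> ?J \<times> ?J \<times> ?B"
  proof
    fix x :: "nat \<times> nat \<times> ('n \<Rightarrow> int)" assume x: "x \<in> grid_points T m k"
    obtain i j z where xe: "x = (i, j, z)" by (cases x)
    have *: "i < j" "real j \<le> T * real k ^ m" "z \<in> ?B" using x by (auto simp: grid_points_def xe)
    hence "j \<le> nat \<lfloor>T * real k ^ m\<rfloor>" by (simp add: le_nat_floor)
    thus "x \<in> ?J \<times> ?J \<times> ?B" using * by (auto simp: xe)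
  qed
  have fin: "finite (?J \<times> ?J \<times> ?B)" by (intro finite_SigmaI card_lattice_box_le) auto
  show "finite (grid_points T m k :: (nat \<times> nat \<times> ('n \<Rightarrow> int)) set)" using sub fin by (rule finite_subset)
  assume k: "1 \<le> k"
  let ?N = "real k ^ m"
  have N: "1 \<le> ?N" using k by (simp add: one_le_power)
  have J: "real (card ?J) \<le> (T + 1) * ?N"
  proof -
    have "real (card ?J) \<le> T * ?N + 1" using assms by (simp add: of_nat_nat)
    thus ?thesis using N by (simp add: algebra_simps)
  qed
  have B: "real (card ?B) \<le> (7 * real k ^ (m + 1)) ^ CARD('n)"
  proof -
    \<comment> \<open>Since k + 2 is at most 3k, the left side is at most 6 + 1 times
      \<open>k ^ (m + 1)\<close>.\<close>
    have "2 * ((k + 2) * k ^ m) + 1 \<le> 7 * k ^ (m + 1)"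
    proof -
      have "(k + 2) * k ^ m \<le> (3 * k) * k ^ m" using k by (intro mult_right_mono) auto
      moreover have "1 \<le> k ^ (m + 1)" using k by (intro one_le_power)
      ultimately show ?thesis by simp
    qed
    hence "(2 * ((k + 2) * k ^ m) + 1) ^ CARD('n) \<le> (7 * k ^ (m + 1)) ^ CARD('n)"
      by (intro power_mono) auto
    hence "real ((2 * ((k + 2) * k ^ m) + 1) ^ CARD('n)) \<le> real ((7 * k ^ (m + 1)) ^ CARD('n))"
      by (rule of_nat_mono)
    thus ?thesis unfolding card_lattice_box_le by simp
  qed
  have "real (card (grid_points T m k :: (nat \<times> nat \<times> ('n \<Rightarrow> int)) set)) \<le> real (card (?J \<times> ?J \<times> ?B))"
    using card_mono[OF fin sub] by simp
  also have "\<dots> = real (card ?J) * (real (card ?J) * real (card ?B))" by (simp only: card_cartesian_product of_nat_mult)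
  also have "\<dots> \<le> ((T + 1) * ?N) * (((T + 1) * ?N) * (7 * real k ^ (m + 1)) ^ CARD('n))"
    using assms by (intro mult_mono J B) (auto intro!: mult_nonneg_nonneg)
  also have "\<dots> = (T + 1)\<^sup>2 * 7 ^ CARD('n) * real k ^ (2 * m + (m + 1) * CARD('n))"
    by (simp add: power2_eq_square power_mult_distrib power_add power_mult mult_2 mult_ac)
  finally show "real (card (grid_points T m k :: (nat \<times> nat \<times> ('n \<Rightarrow> int)) set))
      \<le> (T + 1)\<^sup>2 * 7 ^ CARD('n) * real k ^ (2 * m + (m + 1) * CARD('n))" .
qed

section \<open>Choice of exponents and summation over the grid\<close>

theorem theorem1p4:
  fixes M :: "'a measure" and B :: "real \<Rightarrow> 'a \<Rightarrow> real ^ 'n" and H T \<rho> :: real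
  assumes "prob_space M"
    and "0 < H" and "H < 1"
    and "fractional_brownian_motion M H B"
    and "0 < T"
    and "0 < \<rho>" and "\<rho> < 1 / (2 * H)"
  shows "\<exists>\<gamma>>1/2. AE \<omega> in M. irregular \<rho> \<gamma> T (\<lambda>t. B t \<omega>)"
proof -
  \<comment> \<open>The interval from 2\<rho> to 1/H has length 2\<eta>, and q is its midpoint. One
    half of it keeps q admissible for the moment bound, the other leaves room for \<gamma> and for
    summation.\<close>
  define \<eta> where "\<eta> = 1 / (2 * H) - \<rho>"
  define q where "q = 2 * \<rho> + \<eta>"
  define m :: nat where "m = nat \<lceil>4 * \<rho>\<rceil>"
  \<comment> \<open>The first bound gives \<gamma> at most 3/4. The second limits the loss from
    short intervals: a length of at least \<open>real k powr (- real m)\<close>, raised to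
    -2\<delta>, costs at most \<open>real k powr (\<eta> / 2)\<close>.\<close>
  define \<delta> where "\<delta> = min (1/4) (\<eta> / (4 * real m))"
  define \<gamma> where "\<gamma> = 1/2 + \<delta>"
  define D where "D = 2 * m + (m + 1) * CARD('n)"
  have \<eta>: "0 < \<eta>" using assms by (simp add: \<eta>_def)
  have q: "q < 1 / H" "0 < q"
  proof -
    have "1 / H = 2 * (1 / (2 * H))" using assms by simp
    thus "q < 1 / H" "0 < q" using \<eta> assms(6) by (simp_all add: q_def \<eta>_def)
  qed
  have m: "4 * \<rho> \<le> real m" "0 < real m" using assms(6) by (auto simp: m_def of_nat_nat)
  have \<delta>: "0 < \<delta>" "\<delta> \<le> 1/4" "\<delta> * real m \<le> \<eta> / 4"
  proof -
    show "0 < \<delta>" "\<delta> \<le> 1/4" using \<eta> m by (auto simp: \<delta>_def)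
    have "\<delta> * real m \<le> \<eta> / (4 * real m) * real m" using m by (intro mult_right_mono) (auto simp: \<delta>_def)
    thus "\<delta> * real m \<le> \<eta> / 4" using m by simp
  qed
  \<comment> \<open>\<open>D\<close> is the degree in k of the number of grid points. With this p
    the decay beats the count by two powers of k, so the series over k converges.\<close>
  obtain p :: nat where "(real D + 2) / (\<eta> / 2) < real p" using reals_Archimedean2 by blast
  hence p: "real D + 2 \<le> real p * (\<eta> / 2)" "0 < p"
    using \<eta> by (auto simp: field_simps intro: gr0I)
  obtain C where C: "0 < C" and mom: "\<And>a s t. 0 \<le> s \<Longrightarrow> s < t \<Longrightarrow> t \<le> T \<Longrightarrow> 1 \<le> norm a \<Longrightarrow>
      \<exists>Z \<in> borel_measurable M.
        (\<forall>\<omega>. continuous_on {0..} (\<lambda>t. B t \<omega>) \<longrightarrow>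
          Z \<omega> = ennreal (norm (Phi (\<lambda>t. B t \<omega>) t a - Phi (\<lambda>t. B t \<omega>) s a) ^ (2 * p))) \<and>
        (\<integral>\<^sup>+\<omega>. Z \<omega> \<partial>M) \<le> ennreal (C * ((t - s) * norm a powr (- q)) ^ p)"
    using fbm_Phi_moment_powr[OF assms(1-5) q(1), of p] by blast
  define F :: "nat \<Rightarrow> (nat \<times> nat \<times> ('n \<Rightarrow> int)) set"
    where "F k = (if 2 * CARD('n) \<le> k then grid_points T m k else {})" for k
  define len where "len k x = (case x of (i, j, z) \<Rightarrow> (real j - real i) / real k ^ m)"
    for k and x :: "nat \<times> nat \<times> ('n \<Rightarrow> int)"
  define inc where "inc k x \<omega> = (case x of (i, j, z) \<Rightarrow>
      norm (Phi (\<lambda>t. B t \<omega>) (real j / real k ^ m) (lattice_pt k m z)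
        - Phi (\<lambda>t. B t \<omega>) (real i / real k ^ m) (lattice_pt k m z)))"
    for k \<omega> and x :: "nat \<times> nat \<times> ('n \<Rightarrow> int)"
  \<comment> \<open>The weight turns the required grid bound into
    \<open>wt k x * inc k x \<omega> \<le> K\<close>.\<close>
  define wt where "wt k x = real k powr \<rho> / len k x powr \<gamma>" for k and x :: "nat \<times> nat \<times> ('n \<Rightarrow> int)"
  define c where "c k = C * 2 powr (q * real p) * ((T + 1)\<^sup>2 * 7 ^ CARD('n)) * real k powr (-2)" for k
  have card1: "1 \<le> CARD('n)" using zero_less_card_finite[where 'a='n] by linarith
  have wt0: "0 \<le> wt k x" for k x by (simp add: wt_def)
  define P where "P k x Z \<longleftrightarrow> Z \<in> borel_measurable M \<and>
      (\<forall>\<omega>. continuous_on {0..} (\<lambda>t. B t \<omega>) \<longrightarrow> Z \<omega> = ennreal (inc k x \<omega> ^ (2 * p))) \<and>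
      ennreal (wt k x ^ (2 * p)) * (\<integral>\<^sup>+\<omega>. Z \<omega> \<partial>M) \<le> ennreal (C * 2 powr (q * real p) * real k powr (- (real p * (\<eta> / 2))))"
    for k x Z
  have ex: "\<exists>Z. P k x Z" if x: "x \<in> F k" for k x
  proof -
    obtain i j z where xe: "x = (i, j, z)" by (cases x)
    have kk: "2 * CARD('n) \<le> k" and ij: "i < j" "real j \<le> T * real k ^ m"
      and g: "real k / 2 \<le> norm (lattice_pt k m z :: real ^ 'n)"
      using x by (auto simp: F_def xe grid_points_def split: if_splits)
    have k: "2 \<le> real k" using kk card1 by linarith
    let ?g = "lattice_pt k m z :: real ^ 'n"
    let ?l = "len k x"
    have N: "0 < real k ^ m" using k by simp
    have l: "?l = real j / real k ^ m - real i / real k ^ m" by (simp add: len_def xe diff_divide_distrib)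
    have l0: "real k powr (- real m) \<le> ?l"
    proof -
      have "1 / real k ^ m \<le> (real j - real i) / real k ^ m" using ij N by (intro divide_right_mono) auto
      thus ?thesis using k by (simp add: len_def xe powr_minus powr_realpow divide_inverse)
    qed
    have "0 < real k powr (- real m)" using k by simp
    hence l1: "0 < ?l" using l0 by linarith
    have inc: "inc k x \<omega> = norm (Phi (\<lambda>t. B t \<omega>) (real j / real k ^ m) ?g - Phi (\<lambda>t. B t \<omega>) (real i / real k ^ m) ?g)" for \<omega>
      by (simp add: inc_def xe)
    have st: "0 \<le> real i / real k ^ m" "real i / real k ^ m < real j / real k ^ m"
      "real j / real k ^ m \<le> T" "1 \<le> norm ?g"
      using ij g k N by (auto intro: divide_strict_right_mono simp: pos_divide_le_eq)
    obtain Z where Z: "Z \<in> borel_measurable M"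
      "\<forall>\<omega>. continuous_on {0..} (\<lambda>t. B t \<omega>) \<longrightarrow> Z \<omega> = ennreal (inc k x \<omega> ^ (2 * p))"
      "(\<integral>\<^sup>+\<omega>. Z \<omega> \<partial>M) \<le> ennreal (C * (?l * norm ?g powr (- q)) ^ p)"
      using mom[OF st] unfolding l[symmetric] inc by blast
    have "ennreal (wt k x ^ (2 * p)) * (\<integral>\<^sup>+\<omega>. Z \<omega> \<partial>M)
        \<le> ennreal (wt k x ^ (2 * p)) * ennreal (C * (?l * norm ?g powr (- q)) ^ p)"
      by (intro mult_left_mono Z) auto
    also have "\<dots> = ennreal (C * ((wt k x)\<^sup>2 * (?l * norm ?g powr (- q))) ^ p)"
    proof -
      have "wt k x ^ (2 * p) * (C * (?l * norm ?g powr (- q)) ^ p) = C * ((wt k x)\<^sup>2 * (?l * norm ?g powr (- q))) ^ p"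
        unfolding power_mult[of _ 2 p] power_mult_distrib by (simp only: mult_ac)
      thus ?thesis using wt0 by (simp only: ennreal_mult'[symmetric] zero_le_power)
    qed
    also have "\<dots> \<le> ennreal (C * (2 powr q * real k powr (- (\<eta> / 2))) ^ p)"
    proof (rule ennreal_leI, rule mult_left_mono, rule power_mono)
      \<comment> \<open>The moment carries one power of the length and the squared weight removes
        2\<gamma> of them; the remaining exponent -2\<delta> is slightly negative, so the worst case
        is the shortest grid interval.\<close>
      have "(wt k x)\<^sup>2 * ?l = real k powr (2 * \<rho>) * ?l powr (- (2 * \<delta>))"
      proof -
        have "(wt k x)\<^sup>2 * ?l = real k powr (2 * \<rho>) * (?l powr 1 / ?l powr (2 * \<gamma>))"
          using l1 k by (simp add: wt_def power_divide powr_power)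
        also have "?l powr 1 / ?l powr (2 * \<gamma>) = ?l powr (1 - 2 * \<gamma>)" by (rule powr_diff[symmetric])
        finally show ?thesis by (simp add: \<gamma>_def)
      qed
      also have "\<dots> \<le> real k powr (2 * \<rho>) * (real k powr (- real m)) powr (- (2 * \<delta>))"
        using l0 k \<delta> by (intro mult_left_mono powr_mono2') auto
      also have "\<dots> \<le> real k powr (2 * \<rho>) * real k powr (\<eta> / 2)"
        unfolding powr_powr using k \<delta> by (intro mult_left_mono powr_mono) (auto simp: mult_ac)
      finally have 1: "(wt k x)\<^sup>2 * ?l \<le> real k powr (2 * \<rho> + \<eta> / 2)" by (simp add: powr_add)
      have "norm ?g powr (- q) \<le> (real k / 2) powr (- q)"
        using g k q by (intro powr_mono2') auto
      also have "\<dots> = real k powr (- q) / 2 powr (- q)" by (rule powr_divide)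
      also have "\<dots> = 2 powr q * real k powr (- q)" by (simp add: powr_minus_divide)
      finally have "((wt k x)\<^sup>2 * ?l) * norm ?g powr (- q) \<le> real k powr (2 * \<rho> + \<eta> / 2) * (2 powr q * real k powr (- q))"
        using 1 l1 by (intro mult_mono) auto
      also have "\<dots> = 2 powr q * real k powr (2 * \<rho> + \<eta> / 2 - q)"
        by (simp add: powr_diff powr_minus_divide)
      \<comment> \<open>The net decay per unit of p: of the surplus \<eta> in q, half was spent on
        short intervals.\<close>
      also have "2 * \<rho> + \<eta> / 2 - q = - (\<eta> / 2)" by (simp add: q_def)
      finally show "(wt k x)\<^sup>2 * (?l * norm ?g powr (- q)) \<le> 2 powr q * real k powr (- (\<eta> / 2))"
        by (simp add: mult.assoc)
    qed (use C l1 in auto)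
    also have "C * (2 powr q * real k powr (- (\<eta> / 2))) ^ p
        = C * 2 powr (q * real p) * real k powr (- (real p * (\<eta> / 2)))"
      using k p(2) by (simp add: power_mult_distrib powr_power mult.commute)
    finally show ?thesis unfolding P_def using Z(1,2) by blast
  qed
  \<comment> \<open>The moment bound only asserts existence at each grid point; choosing one
    variable per point gives a family that can be summed.\<close>
  define Z where "Z k x = (SOME Z. P k x Z)" for k x
  have "P k x (Z k x)" if "x \<in> F k" for k x
    unfolding Z_def using ex[OF that] by (rule someI_ex)
  hence Z: "\<And>k x. x \<in> F k \<Longrightarrow> Z k x \<in> borel_measurable M"
    "\<And>k x \<omega>. x \<in> F k \<Longrightarrow> continuous_on {0..} (\<lambda>t. B t \<omega>) \<Longrightarrow> Z k x \<omega> = ennreal (inc k x \<omega> ^ (2 * p))"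
    "\<And>k x. x \<in> F k \<Longrightarrow> ennreal (wt k x ^ (2 * p)) * (\<integral>\<^sup>+\<omega>. Z k x \<omega> \<partial>M)
      \<le> ennreal (C * 2 powr (q * real p) * real k powr (- (real p * (\<eta> / 2))))"
    unfolding P_def by blast+
  have "AE \<omega> in M. \<exists>K\<ge>1. \<forall>k. \<forall>x\<in>F k. ennreal (wt k x ^ (2 * p)) * Z k x \<omega> \<le> ennreal K"
  proof (rule AE_bounded_of_summable_nn_integral)
    show "(\<lambda>\<omega>. ennreal (wt k x ^ (2 * p)) * Z k x \<omega>) \<in> borel_measurable M" if "x \<in> F k" for k x
      using Z(1)[OF that] by simp
    show "finite (F k)" for k by (simp add: F_def grid_points_card assms)
    show "summable c" unfolding c_def by (intro summable_mult) (simp add: summable_real_powr_iff)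
    show "0 \<le> c k" for k using C by (simp add: c_def)
    show "(\<Sum>x\<in>F k. \<integral>\<^sup>+\<omega>. ennreal (wt k x ^ (2 * p)) * Z k x \<omega> \<partial>M) \<le> ennreal (c k)" for k
    proof (cases "2 * CARD('n) \<le> k")
      case True
      hence k: "1 \<le> k" using card1 by linarith
      let ?b = "C * 2 powr (q * real p) * real k powr (- (real p * (\<eta> / 2)))"
      have b: "0 \<le> ?b" using C by simp
      have "(\<Sum>x\<in>F k. \<integral>\<^sup>+\<omega>. ennreal (wt k x ^ (2 * p)) * Z k x \<omega> \<partial>M) \<le> (\<Sum>x\<in>F k. ennreal ?b)"
        using Z(1,3) by (intro sum_mono) (simp add: nn_integral_cmult)
      also have "\<dots> = ennreal (real (card (F k)) * ?b)"
        using b by (simp add: ennreal_mult' ennreal_of_nat_eq_real_of_nat)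
      also have "\<dots> \<le> ennreal (((T + 1)\<^sup>2 * 7 ^ CARD('n) * real k ^ D) * ?b)"
        using grid_points_card(2)[OF assms(5) k, of m, where 'n='n] True b
        by (intro ennreal_leI mult_right_mono) (auto simp: F_def D_def)
      also have "\<dots> = ennreal (C * 2 powr (q * real p) * ((T + 1)\<^sup>2 * 7 ^ CARD('n)) * (real k powr real D * real k powr (- (real p * (\<eta> / 2)))))"
        using k by (simp add: powr_realpow mult_ac)
      also have "\<dots> \<le> ennreal (c k)"
        unfolding c_def powr_add[symmetric] using p C k
        by (intro ennreal_leI mult_left_mono powr_mono) auto
      finally show ?thesis .
    qed (simp add: F_def)
  qed
  moreover have "AE \<omega> in M. continuous_on {0..} (\<lambda>t. B t \<omega>)"
    using assms(4) by (simp add: fractional_brownian_motion_def)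
  ultimately have "AE \<omega> in M. irregular \<rho> \<gamma> T (\<lambda>t. B t \<omega>)"
  proof eventually_elim
    case (elim \<omega>)
    then obtain K where K: "1 \<le> K" "\<And>k x. x \<in> F k \<Longrightarrow> ennreal (wt k x ^ (2 * p)) * Z k x \<omega> \<le> ennreal K"
      by blast
    have bound: "inc k x \<omega> \<le> K * len k x powr \<gamma> * real k powr (- \<rho>)"
      if x: "x \<in> F k" "0 < len k x" "1 \<le> k" for k x
    proof -
      have "ennreal ((wt k x * inc k x \<omega>) ^ (2 * p)) \<le> ennreal K"
        using K(2)[OF x(1)] Z(2)[OF x(1) elim(2)] wt0[of k x]
        by (simp add: power_mult_distrib ennreal_mult')
      hence "(wt k x * inc k x \<omega>) ^ (2 * p) \<le> K" using K(1) by (simp add: ennreal_le_iff)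
      \<comment> \<open>As K is at least 1, the bound K on the 2p-th power also bounds the base,
        without introducing a root.\<close>
      also have "K \<le> K ^ (2 * p)" using K(1) p(2) by (intro self_le_power) auto
      finally have "wt k x * inc k x \<omega> \<le> K"
        using K(1) p(2) by (subst (asm) power_mono_iff) (auto simp: wt0 inc_def split: prod.split)
      hence "inc k x \<omega> * real k powr \<rho> \<le> K * len k x powr \<gamma>"
        using x(2) by (simp add: wt_def pos_divide_le_eq mult.commute)
      hence "inc k x \<omega> \<le> K * len k x powr \<gamma> / real k powr \<rho>"
        using x(3) by (simp add: pos_le_divide_eq)
      thus ?thesis by (simp add: powr_minus divide_inverse)
    qed
    show "irregular \<rho> \<gamma> T (\<lambda>t. B t \<omega>)"
    proof (rule irregular_of_grid[OF elim(2) assms(5), where K = K and m = m])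
      fix k i j and z :: "'n \<Rightarrow> int"
      assume *: "2 * CARD('n) \<le> k" "i < j" "real j \<le> T * real k ^ m" "\<And>c. \<bar>z c\<bar> \<le> int ((k + 2) * k ^ m)"
        "real k / 2 \<le> norm (lattice_pt k m z :: real ^ 'n)"
      have x: "(i, j, z) \<in> F k" using * by (simp add: F_def grid_points_def)
      have k: "1 \<le> k" using *(1) card1 by linarith
      have "0 < len k (i, j, z)" using *(2) k by (simp add: len_def)
      from bound[OF x this k]
      show "norm (Phi (\<lambda>t. B t \<omega>) (real j / real k ^ m) (lattice_pt k m z)
          - Phi (\<lambda>t. B t \<omega>) (real i / real k ^ m) (lattice_pt k m z))
          \<le> K * ((real j - real i) / real k ^ m) powr \<gamma> * real k powr (- \<rho>)"
        by (simp add: inc_def len_def)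
    qed (use \<delta> m K assms(6) in \<open>auto simp: \<gamma>_def\<close>)
  qed
  moreover have "1/2 < \<gamma>" using \<delta> by (simp add: \<gamma>_def)
  ultimately show ?thesis by blast
qed

end
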